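(* Let $\nu$ be a probability measure on the discrete cube $\mathcal{C}_n=\{-1,1\}^n$. Then for every $\varepsilon \in (0,1/16)$ there exists a probability measure $\tilde\nu$ on $\mathcal{C}_n$ such that, defining $f,\tilde f$ by $\frac{d\nu}{d\mu}=e^{f}$ and $\frac{d\tilde\nu}{d\mu}=e^{\tilde f}$, one has $$|f(y)-\tilde f(y)|\le \varepsilon n\qquad \forall y\in\mathcal{C}_n,$$ and, for the unique product measure $\xi$ on $\mathcal{C}_n$ satisfying $\int y\,d\xi(y)=\int y\,d\tilde\nu(y)$, $$\mathrm{W}_1(\tilde\nu,\xi)\le 2^7\sqrt{\frac{n\,\mathcal{D}(\nu)}{\varepsilon}}+4n e^{-\frac{1}{64\varepsilon^2}}.$$ Furthermore, there exists a set $I\subseteq[n]$ with $|I|\ge n-2ne^{-\frac{1}{32\varepsilon^2}}$ such that, letting $\xi':=\pi_I(\xi)\times\pi_{[n]\setminus I}(\tilde\nu)$, one has $$\mathrm{W}_1(\tilde\nu,\xi')\le 2^6\sqrt{\frac{n\,\mathcal{D}(\nu)}{\varepsilon}}.$$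
   Context: $\mu$ denotes the uniform probability measure on $\mathcal{C}_n=\{-1,1\}^n$. For $g:\mathcal{C}_n\to\mathbb{R}$, $y\in\mathcal{C}_n$ and $i\in[n]$, the discrete derivative is $\partial_i g(y)=\frac12\big(g(y_1,\dots,y_{i-1},1,y_{i+1},\dots,y_n)-g(y_1,\dots,y_{i-1},-1,y_{i+1},\dots,y_n)\big)$ and the discrete gradient is $\nabla g(y)=(\partial_1 g(y),\dots,\partial_n g(y))$. The Gaussian width of $K\subset\mathbb{R}^n$ is $\mathbf{GW}(K)=\mathbb{E}\sup_{x\in K}\langle x,\Gamma\rangle$ with $\Gamma\sim N(0,\mathrm{Id}_n)$. The gradient complexity of $g$ is $\mathcal{D}(g)=\mathbf{GW}(\{\nabla g(y):y\in\mathcal{C}_n\}\cup\{0\})$, and for a measure $\nu$ on $\mathcal{C}_n$, $\mathcal{D}(\nu):=\mathcal{D}(\log\frac{d\nu}{d\mu})$. $\mathrm{W}_1(\nu_1,\nu_2)=\inf\mathbb{E}\, d_H(X,Y)$ over couplings $X\sim\nu_1,Y\sim\nu_2$, with $d_H$ the Hamming distance. A product measure on $\mathcal{C}_n$ is the law of a vector with independent coordinates. For a measure $\rho$ on $\mathcal{C}_n$ and $J\subseteq[n]$, $\pi_J(\rho)$ denotes the marginal law of $\rho$ on the coordinates in $J$. *)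

theory Defs
  imports "HOL-Probability.Probability"
begin

definition cube :: "nat \<Rightarrow> (nat \<Rightarrow> real) set" where
  "cube n = {y. (\<forall>i<n. y i = 1 \<or> y i = -1) \<and> (\<forall>i. n \<le> i \<longrightarrow> y i = 0)}"

definition unif_cube :: "nat \<Rightarrow> (nat \<Rightarrow> real) pmf" where
  "unif_cube n = pmf_of_set (cube n)"

text \<open>Log-density f = log (d nu / d mu) of a measure with full support on C_n.\<close>
definition log_density :: "nat \<Rightarrow> (nat \<Rightarrow> real) pmf \<Rightarrow> (nat \<Rightarrow> real) \<Rightarrow> real" where
  "log_density n \<nu> y = ln (pmf \<nu> y / pmf (unif_cube n) y)"

definition dpartial :: "((nat \<Rightarrow> real) \<Rightarrow> real) \<Rightarrow> nat \<Rightarrow> (nat \<Rightarrow> real) \<Rightarrow> real" where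
  "dpartial g i y = (g (y(i := 1)) - g (y(i := -1))) / 2"

definition dgrad :: "nat \<Rightarrow> ((nat \<Rightarrow> real) \<Rightarrow> real) \<Rightarrow> (nat \<Rightarrow> real) \<Rightarrow> (nat \<Rightarrow> real)" where
  "dgrad n g y = (\<lambda>i. if i < n then dpartial g i y else 0)"

definition gauss :: "nat \<Rightarrow> (nat \<Rightarrow> real) measure" where
  "gauss n = PiM {..<n} (\<lambda>_. density lborel std_normal_density)"

definition gaussian_width :: "nat \<Rightarrow> (nat \<Rightarrow> real) set \<Rightarrow> real" where
  "gaussian_width n K = (\<integral>z. (SUP x\<in>K. (\<Sum>i<n. x i * z i)) \<partial>gauss n)"

definition grad_complexity :: "nat \<Rightarrow> ((nat \<Rightarrow> real) \<Rightarrow> real) \<Rightarrow> real" where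
  "grad_complexity n g = gaussian_width n (insert (\<lambda>_. 0) (dgrad n g ` cube n))"

definition meas_complexity :: "nat \<Rightarrow> (nat \<Rightarrow> real) pmf \<Rightarrow> real" where
  "meas_complexity n \<nu> = grad_complexity n (log_density n \<nu>)"

definition hamming :: "nat \<Rightarrow> (nat \<Rightarrow> real) \<Rightarrow> (nat \<Rightarrow> real) \<Rightarrow> real" where
  "hamming n x y = real (card {i. i < n \<and> x i \<noteq> y i})"

definition W1 :: "nat \<Rightarrow> (nat \<Rightarrow> real) pmf \<Rightarrow> (nat \<Rightarrow> real) pmf \<Rightarrow> real" where
  "W1 n \<nu>1 \<nu>2 = Inf {measure_pmf.expectation c (\<lambda>(x, y). hamming n x y) | c.
       map_pmf fst c = \<nu>1 \<and> map_pmf snd c = \<nu>2}"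

definition product_on_cube :: "nat \<Rightarrow> (nat \<Rightarrow> real) pmf \<Rightarrow> bool" where
  "product_on_cube n \<xi> \<longleftrightarrow> set_pmf \<xi> \<subseteq> cube n \<and>
     (\<forall>y\<in>cube n. pmf \<xi> y = (\<Prod>i<n. pmf (map_pmf (\<lambda>z. z i) \<xi>) (y i)))"

definition marginal :: "nat set \<Rightarrow> (nat \<Rightarrow> real) pmf \<Rightarrow> (nat \<Rightarrow> real) pmf" where
  "marginal J \<rho> = map_pmf (\<lambda>y i. if i \<in> J then y i else 0) \<rho>"

definition glue :: "nat set \<Rightarrow> (nat \<Rightarrow> real) pmf \<Rightarrow> nat set \<Rightarrow> (nat \<Rightarrow> real) pmf \<Rightarrow> (nat \<Rightarrow> real) pmf" where
  "glue I \<rho>1 J \<rho>2 = map_pmf (\<lambda>(a, b) i. if i \<in> I then a i else b i)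
      (pair_pmf (marginal I \<rho>1) (marginal J \<rho>2))"

end

theory Submission
  imports Defs "HOL-Real_Asymp.Real_Asymp"
begin

text \<open>The measure is tilted by \<open>exp \<langle>\<theta>, y\<rangle>\<close> with \<open>\<theta> = \<sigma> \<Gamma>\<close>, \<open>\<Gamma>\<close> a standard Gaussian vector and
  \<open>\<sigma> = \<epsilon> / 4\<close>. Gaussian integration by parts turns the expectation of \<open>\<langle>\<Gamma>, E\<^sub>\<theta> \<nabla>f\<rangle>\<close>, which is at most
  the gradient complexity \<open>D\<close>, into that of \<open>\<sigma> \<Sum>\<^sub>i Cov\<^sub>\<theta>(y\<^sub>i, \<partial>\<^sub>i f)\<close>. The conditional mean of
  \<open>y\<^sub>i\<close> given the other coordinates is \<open>g\<^sub>i = tanh (\<partial>\<^sub>i f + \<theta>\<^sub>i)\<close>, so this covariance equals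
  \<open>Cov\<^sub>\<theta>(g\<^sub>i, \<partial>\<^sub>i f)\<close>, which dominates \<open>Var\<^sub>\<theta>(g\<^sub>i)\<close> because tanh is increasing and 1-Lipschitz.
  Hence some \<open>\<theta>\<close> with \<open>\<Sum>\<^sub>i \<bar>\<theta>\<^sub>i\<bar> \<le> 2 \<sigma> n\<close> has \<open>\<Sum>\<^sub>i Var\<^sub>\<theta>(g\<^sub>i) \<le> 8 D / \<epsilon>\<close>. Coupling the tilted measure
  with the product measure one coordinate after the other costs at most half the sum of the mean
  deviations of the \<open>g\<^sub>i\<close>, and Cauchy-Schwarz gives a distance of at most \<open>2 sqrt (n D / \<epsilon>)\<close>. No
  coordinate has to be discarded: \<open>I\<close> is everything, and \<open>\<xi>' = \<xi>\<close>.\<close>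

subsection \<open>Gaussian integration by parts\<close>

text \<open>Stein's identity on the line. Since \<open>t * std_normal_density t\<close> is minus the
  derivative of the density, the difference of the two weighted integrands is the derivative of
  minus density times \<open>G\<close>, which vanishes at both ends because \<open>G\<close> is
  bounded.\<close>

lemma std_normal_integration_by_parts:
  fixes G G' :: "real \<Rightarrow> real"
  assumes deriv: "\<And>t. (G has_real_derivative G' t) (at t)"
    and cont: "\<And>t. isCont G' t"
    and bnd: "\<And>t. \<bar>G t\<bar> \<le> B" "\<And>t. \<bar>G' t\<bar> \<le> B'"
  shows "(\<integral>t. t * G t \<partial>density lborel std_normal_density) =
         (\<integral>t. G' t \<partial>density lborel std_normal_density)"
proof -
  let ?\<phi> = "std_normal_density"
  have contG: "isCont G t" for t
    using deriv DERIV_isCont by blast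
  have [measurable]: "G \<in> borel_measurable borel" "G' \<in> borel_measurable borel"
    using contG cont by (auto intro!: borel_measurable_continuous_onI continuous_at_imp_continuous_on)
  have int1: "integrable lborel (\<lambda>t. ?\<phi> t * (t * G t))"
  proof (rule Bochner_Integration.integrable_bound)
    show "integrable lborel (\<lambda>t. B * (?\<phi> t * \<bar>t\<bar>^1))"
      using integrable_std_normal_moment_abs[of 1] by (intro integrable_mult_right) auto
    show "AE t in lborel. norm (?\<phi> t * (t * G t)) \<le> norm (B * (?\<phi> t * \<bar>t\<bar>^1))"
    proof (rule AE_I2)
      fix t
      have "?\<phi> t * (\<bar>t\<bar> * \<bar>G t\<bar>) \<le> ?\<phi> t * (\<bar>t\<bar> * \<bar>B\<bar>)"
        using bnd(1)[of t] by (intro mult_left_mono) (auto simp: normal_density_nonneg)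
      then show "norm (?\<phi> t * (t * G t)) \<le> norm (B * (?\<phi> t * \<bar>t\<bar>^1))"
        by (simp add: abs_mult normal_density_nonneg mult_ac)
    qed
  qed measurable
  have int2: "integrable lborel (\<lambda>t. ?\<phi> t * G' t)"
  proof (rule Bochner_Integration.integrable_bound)
    show "integrable lborel (\<lambda>t. B' * ?\<phi> t)"
      by (intro integrable_mult_right) auto
    show "AE t in lborel. norm (?\<phi> t * G' t) \<le> norm (B' * ?\<phi> t)"
    proof (rule AE_I2)
      fix t
      have "?\<phi> t * \<bar>G' t\<bar> \<le> ?\<phi> t * \<bar>B'\<bar>"
        using bnd(2)[of t] by (intro mult_left_mono) (auto simp: normal_density_nonneg)
      then show "norm (?\<phi> t * G' t) \<le> norm (B' * ?\<phi> t)"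
        by (simp add: abs_mult normal_density_nonneg mult_ac)
    qed
  qed measurable
  define F where "F t = - ?\<phi> t * G t" for t
  define F' where "F' t = ?\<phi> t * (t * G t) - ?\<phi> t * G' t" for t
  have dphi: "(?\<phi> has_real_derivative - t * ?\<phi> t) (at t)" for t
  proof -
    define c :: real where "c = 1 / sqrt (2 * pi)"
    have "((\<lambda>t. c * exp (- t\<^sup>2 / 2)) has_real_derivative - t * (c * exp (- t\<^sup>2 / 2))) (at t)"
      by (auto intro!: derivative_eq_intros)
    then show ?thesis
      by (simp add: std_normal_density_def[abs_def] c_def)
  qed
  have dF: "(F has_real_derivative F' t) (at t)" for t
    unfolding F_def F'_def
    by (auto intro!: derivative_eq_intros dphi deriv simp: algebra_simps)
  have contF': "isCont F' t" for t
    unfolding F'_def normal_density_def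
    by (intro continuous_intros contG cont) auto
  have intF': "integrable lborel F'"
    unfolding F'_def using int1 int2 by simp
  have bF: "norm (F t) \<le> ?\<phi> t * B" for t
    unfolding F_def using bnd(1)[of t]
    by (simp add: abs_mult normal_density_nonneg mult_left_mono)
  have lim: "(F \<longlongrightarrow> 0) at_top" "(F \<longlongrightarrow> 0) at_bot"
  proof -
    have "((\<lambda>t. ?\<phi> t * B) \<longlongrightarrow> 0) at_top"
      unfolding normal_density_def by real_asymp
    then show "(F \<longlongrightarrow> 0) at_top"
      by (rule Lim_null_comparison[rotated]) (use bF in auto)
    have "((\<lambda>t. ?\<phi> t * B) \<longlongrightarrow> 0) at_bot"
      unfolding normal_density_def by real_asymp
    then show "(F \<longlongrightarrow> 0) at_bot"
      by (rule Lim_null_comparison[rotated]) (use bF in auto)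
  qed
  have "(LBINT t=-\<infinity>..\<infinity>. F' t) = 0 - 0"
  proof (rule interval_integral_FTC_integrable)
    show "((F \<circ> real_of_ereal) \<longlongrightarrow> 0) (at_right (-\<infinity>))"
      using lim(2) by (simp add: ereal_tendsto_simps)
    show "((F \<circ> real_of_ereal) \<longlongrightarrow> 0) (at_left \<infinity>)"
      using lim(1) by (simp add: ereal_tendsto_simps)
    show "set_integrable lborel (einterval (-\<infinity>) \<infinity>) F'"
      using intF' by (simp add: set_integrable_def)
  qed (use dF contF' in \<open>auto simp: has_real_derivative_iff_has_vector_derivative\<close>)
  then have "(\<integral>t. F' t \<partial>lborel) = 0"
    by (simp add: interval_lebesgue_integral_def set_lebesgue_integral_def)
  then have "(\<integral>t. ?\<phi> t * (t * G t) \<partial>lborel) = (\<integral>t. ?\<phi> t * G' t \<partial>lborel)"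
    unfolding F'_def using int1 int2 by simp
  then show ?thesis
    by (simp add: integral_density)
qed

section \<open>Standard Gaussian vectors\<close>

interpretation std_normal: prob_space "density lborel std_normal_density"
  by (rule prob_space_normal_density) simp

interpretation std_normals: product_prob_space "\<lambda>_::nat. density lborel std_normal_density" I for I
  by standard

lemma prob_space_gauss: "prob_space (gauss n)"
  unfolding gauss_def by (rule prob_space_PiM) (rule std_normal.prob_space_axioms)

lemma gauss_component_measurable [measurable]:
  "i < n \<Longrightarrow> (\<lambda>z. z i) \<in> borel_measurable (gauss n)"
  unfolding gauss_def by measurable

text \<open>The exact mean \<open>sqrt (2/pi)\<close> is rounded up to 1, so that the sum of all
  \<open>n\<close> absolute values has mean at most \<open>n\<close>; this is what later keeps the
  tilt small.\<close>

lemma gauss_abs_component: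
  assumes "i < n"
  shows "integrable (gauss n) (\<lambda>z. \<bar>z i\<bar>)" "(\<integral>z. \<bar>z i\<bar> \<partial>gauss n) \<le> 1"
proof -
  let ?N = "density lborel std_normal_density"
  have D: "distr (gauss n) ?N (\<lambda>z. z i) = ?N"
    unfolding gauss_def by (rule std_normals.PiM_component) (use assms in auto)
  have M: "(\<lambda>z. z i) \<in> measurable (gauss n) ?N"
    using gauss_component_measurable[OF assms] by simp
  \<comment> \<open>The mean absolute value is the instance \<open>k = 0\<close> of the odd absolute
    moments.\<close>
  have "has_bochner_integral lborel (\<lambda>x. std_normal_density x * \<bar>x\<bar>^(2*0+1)) (sqrt (2/pi) * 2^0 * fact 0)"
    by (rule std_normal_moment_abs_odd)
  then have *: "integrable ?N (\<lambda>x. \<bar>x\<bar>)" "(\<integral>x. \<bar>x\<bar> \<partial>?N) = sqrt (2/pi)"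
    by (auto simp: integrable_density integral_density has_bochner_integral_iff)
  have "sqrt (2/pi) \<le> 1"
    using pi_gt3 by (simp add: real_sqrt_le_1_iff)
  then show "integrable (gauss n) (\<lambda>z. \<bar>z i\<bar>)" "(\<integral>z. \<bar>z i\<bar> \<partial>gauss n) \<le> 1"
    using * integrable_distr_eq[OF M, of "\<lambda>x. \<bar>x\<bar>"] integral_distr[OF M, of "\<lambda>x. \<bar>x\<bar>"]
    unfolding D by auto
qed

lemma integrable_gauss_bounded:
  fixes G :: "(nat \<Rightarrow> real) \<Rightarrow> real"
  assumes "G \<in> borel_measurable (gauss n)" "\<And>z. \<bar>G z\<bar> \<le> B"
  shows "integrable (gauss n) G"
proof -
  interpret prob_space "gauss n" by (rule prob_space_gauss)
  show ?thesis
    by (rule integrable_const_bound[of _ B]) (use assms in auto)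
qed

lemma integrable_gauss_mult_component:
  fixes G :: "(nat \<Rightarrow> real) \<Rightarrow> real"
  assumes "i < n" "G \<in> borel_measurable (gauss n)" "\<And>z. \<bar>G z\<bar> \<le> B"
  shows "integrable (gauss n) (\<lambda>z. z i * G z)"
proof (rule Bochner_Integration.integrable_bound)
  show "integrable (gauss n) (\<lambda>z. B * \<bar>z i\<bar>)"
    using gauss_abs_component[OF assms(1)] by simp
  show "(\<lambda>z. z i * G z) \<in> borel_measurable (gauss n)"
    using assms by measurable
  show "AE z in gauss n. norm (z i * G z) \<le> norm (B * \<bar>z i\<bar>)"
  proof (rule AE_I2)
    fix z
    have "\<bar>G z\<bar> * \<bar>z i\<bar> \<le> \<bar>B\<bar> * \<bar>z i\<bar>"
      using assms(3)[of z] by (intro mult_right_mono) auto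
    then show "norm (z i * G z) \<le> norm (B * \<bar>z i\<bar>)"
      by (simp add: abs_mult mult_ac)
  qed
qed

text \<open>Fubini singles out coordinate \<open>i\<close>; with the other coordinates frozen, this
  is the one-dimensional identity. The uniform bounds supply integrability on the product
  space.\<close>

lemma gauss_integration_by_parts:
  fixes G G' :: "(nat \<Rightarrow> real) \<Rightarrow> real"
  assumes i: "i < n"
    and meas: "G \<in> borel_measurable (gauss n)" "G' \<in> borel_measurable (gauss n)"
    and deriv: "\<And>z t. ((\<lambda>t. G (z(i := t))) has_real_derivative G' (z(i := t))) (at t)"
    and cont: "\<And>z t. isCont (\<lambda>t. G' (z(i := t))) t"
    and bnd: "\<And>z. \<bar>G z\<bar> \<le> B" "\<And>z. \<bar>G' z\<bar> \<le> B'"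
  shows "(\<integral>z. z i * G z \<partial>gauss n) = (\<integral>z. G' z \<partial>gauss n)"
proof -
  let ?N = "density lborel std_normal_density"
  let ?J = "{..<n} - {i}"
  have ins: "insert i ?J = {..<n}" using i by auto
  have *: "(\<integral>z. f z \<partial>gauss n) = (\<integral>x. (\<integral>y. f (x(i:=y)) \<partial>?N) \<partial>PiM ?J (\<lambda>_. ?N))"
    if "integrable (gauss n) f" for f :: "(nat \<Rightarrow> real) \<Rightarrow> real"
    using std_normals.product_integral_insert[of ?J i f] that i
    unfolding gauss_def ins by auto
  have 1: "(\<integral>z. z i * G z \<partial>gauss n) = (\<integral>x. (\<integral>t. t * G (x(i := t)) \<partial>?N) \<partial>PiM ?J (\<lambda>_. ?N))"
    using *[OF integrable_gauss_mult_component[OF i meas(1) bnd(1)]] by simp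
  show ?thesis
    unfolding 1 *[OF integrable_gauss_bounded[OF meas(2) bnd(2)]]
    by (rule Bochner_Integration.integral_cong[OF refl],
        rule std_normal_integration_by_parts[OF deriv cont bnd])
qed

subsection \<open>Sequential coupling on the cube\<close>

lemma cube_eq_PiE_dflt: "cube n = PiE_dflt {..<n} 0 (\<lambda>_. {1, -1})"
  unfolding cube_def PiE_dflt_def by (auto simp: not_less)

lemma finite_cube: "finite (cube n)"
  unfolding cube_eq_PiE_dflt by (rule finite_PiE_dflt) auto

lemma card_cube: "card (cube n) = 2 ^ n"
  unfolding cube_eq_PiE_dflt by (subst card_PiE_dflt) (auto simp: numeral_2_eq_2)

lemma cube_nonempty: "cube n \<noteq> {}"
  using card_cube[of n] by auto

lemma cube_fun_upd: "y \<in> cube n \<Longrightarrow> i < n \<Longrightarrow> s = 1 \<or> s = -1 \<Longrightarrow> y(i := s) \<in> cube n"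
  unfolding cube_def by auto

lemma cube_abs: "y \<in> cube n \<Longrightarrow> i < n \<Longrightarrow> \<bar>y i\<bar> = 1"
  unfolding cube_def by auto

lemma expectation_cube:
  fixes h :: "(nat \<Rightarrow> real) \<Rightarrow> real"
  assumes "set_pmf \<nu> \<subseteq> cube n"
  shows "measure_pmf.expectation \<nu> h = (\<Sum>y\<in>cube n. pmf \<nu> y * h y)"
  by (subst integral_measure_pmf_real[OF finite_cube[of n]]) (use assms in \<open>auto simp: mult.commute\<close>)

lemma sum_pmf_cube: "set_pmf \<nu> \<subseteq> cube n \<Longrightarrow> (\<Sum>y\<in>cube n. pmf \<nu> y) = 1"
  using finite_cube by (rule sum_pmf_eq_1)

section \<open>Optimal couplings of two signs\<close>

lemma bernoulli_coupling:
  assumes "0 \<le> a" "a \<le> 1" "0 \<le> b" "b \<le> 1"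
  shows "\<exists>c. map_pmf fst c = bernoulli_pmf a \<and> map_pmf snd c = bernoulli_pmf b \<and>
             measure_pmf.prob c {z. fst z \<noteq> snd z} = \<bar>a - b\<bar>"
proof -
  have ordered: "\<exists>c. map_pmf fst c = bernoulli_pmf a \<and> map_pmf snd c = bernoulli_pmf b \<and>
             measure_pmf.prob c {z. fst z \<noteq> snd z} = b - a"
    if ab: "0 \<le> a" "a \<le> b" "b \<le> 1" for a b :: real
  proof -
    \<comment> \<open>Thinning: a success of probability \<open>b\<close> is kept with probability
      \<open>r\<close>, so the two outcomes differ exactly when a success is dropped, with
      probability \<open>b * (1 - r) = b - a\<close>. If \<open>b = 0\<close> then
      \<open>a = 0\<close>, and the default value 0 of the division still satisfies
      \<open>r * b = a\<close>.\<close>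
    define r where "r = a / b"
    have r: "0 \<le> r" "r \<le> 1" "0 \<le> b" and rb: "r * b = a"
      using ab by (auto simp: r_def divide_le_eq_1)
    have pb: "measure_pmf.prob (bernoulli_pmf b) {True} = b"
      using ab by (simp add: measure_pmf_single)
    define c where "c = bernoulli_pmf b \<bind> (\<lambda>s. bernoulli_pmf r \<bind> (\<lambda>t. return_pmf (s \<and> t, s)))"
    have 1: "map_pmf fst c = bernoulli_pmf a"
    proof (rule pmf_eqI)
      fix i :: bool
      show "pmf (map_pmf fst c) i = pmf (bernoulli_pmf a) i"
        using r ab unfolding rb[symmetric]
        by (cases i) (simp_all add: pb c_def map_bind_pmf pmf_bind mult_le_one algebra_simps)
    qed
    have 2: "map_pmf snd c = bernoulli_pmf b"
      by (simp add: c_def map_bind_pmf bind_return_pmf')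
    have "measure_pmf.prob c {z. fst z \<noteq> snd z} = pmf (map_pmf (\<lambda>z. fst z \<noteq> snd z) c) True"
      by (simp add: pmf_map vimage_def)
    also have "\<dots> = b - a"
      using r ab unfolding rb[symmetric] by (simp add: c_def map_bind_pmf pmf_bind algebra_simps)
    finally show ?thesis using 1 2 by blast
  qed
  show ?thesis
  proof (cases "a \<le> b")
    case True
    then show ?thesis using ordered[of a b] assms by auto
  next
    case False
    then obtain c where c: "map_pmf fst c = bernoulli_pmf b" "map_pmf snd c = bernoulli_pmf a"
      "measure_pmf.prob c {z. fst z \<noteq> snd z} = a - b"
      using ordered[of b a] assms by auto
    have "prod.swap -` {z. fst z \<noteq> snd z} = {z :: bool \<times> bool. fst z \<noteq> snd z}"
      by auto
    then have "measure_pmf.prob (map_pmf prod.swap c) {z. fst z \<noteq> snd z} = a - b"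
      unfolding measure_map_pmf c(3)[symmetric] by (rule arg_cong)
    then show ?thesis
      using c(1,2) False by (intro exI[of _ "map_pmf prod.swap c"]) (auto simp: map_pmf_comp)
  qed
qed

text \<open>The probability of \<open>1\<close> determines a law on signs, so couplings carry over
  from Boolean laws; the affine formula for the mean lets their cost be read off from means.\<close>

lemma sign_pmf_eq_bernoulli:
  fixes p :: "real pmf"
  assumes "set_pmf p \<subseteq> {-1, 1}"
  shows "p = map_pmf (\<lambda>b. if b then 1 else -1) (bernoulli_pmf (pmf p 1))"
    and "measure_pmf.expectation p (\<lambda>x. x) = 2 * pmf p 1 - 1"
proof -
  have s: "pmf p 1 + pmf p (-1) = 1"
    using sum_pmf_eq_1[of "{-1, 1::real}" p] assms by simp
  show "measure_pmf.expectation p (\<lambda>x. x) = 2 * pmf p 1 - 1"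
    by (subst integral_measure_pmf_real[of "{-1,1}"]) (use assms s in auto)
  have inj: "inj (\<lambda>b. if b then 1 else -1 :: real)"
    by (auto simp: inj_def)
  show "p = map_pmf (\<lambda>b. if b then 1 else -1) (bernoulli_pmf (pmf p 1))" (is "_ = ?q")
  proof (rule pmf_eqI)
    fix x :: real
    have 1: "pmf ?q 1 = pmf p 1"
      using pmf_map_inj'[OF inj, of "bernoulli_pmf (pmf p 1)" True] by (simp add: pmf_le_1)
    have 2: "pmf ?q (-1) = 1 - pmf p 1"
      using pmf_map_inj'[OF inj, of "bernoulli_pmf (pmf p 1)" False] by (simp add: pmf_le_1)
    consider "x = 1" | "x = -1" | "x \<notin> {-1, 1}" by auto
    then show "pmf p x = pmf ?q x"
    proof cases
      case 3
      then have "x \<notin> set_pmf p" "x \<notin> set_pmf ?q"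
        using assms by (auto split: if_splits)
      then show ?thesis by (metis pmf_eq_0_set_pmf)
    qed (use 1 2 s in auto)
  qed
qed

text \<open>The mean changes twice as fast as the probability of \<open>1\<close>, whence the factor
  1/2. Relabelling Booleans as signs is injective and preserves the event of disagreement.\<close>

lemma sign_coupling:
  fixes p q :: "real pmf"
  assumes "set_pmf p \<subseteq> {-1, 1}" "set_pmf q \<subseteq> {-1, 1}"
  shows "\<exists>c. map_pmf fst c = p \<and> map_pmf snd c = q \<and>
    measure_pmf.prob c {z. fst z \<noteq> snd z} =
      \<bar>measure_pmf.expectation p (\<lambda>x. x) - measure_pmf.expectation q (\<lambda>x. x)\<bar> / 2"
proof -
  let ?s = "\<lambda>b. if b then 1 else -1 :: real"
  obtain c where c: "map_pmf fst c = bernoulli_pmf (pmf p 1)" "map_pmf snd c = bernoulli_pmf (pmf q 1)"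
    "measure_pmf.prob c {z. fst z \<noteq> snd z} = \<bar>pmf p 1 - pmf q 1\<bar>"
    using bernoulli_coupling[of "pmf p 1" "pmf q 1"] by (auto simp: pmf_le_1)
  let ?c = "map_pmf (map_prod ?s ?s) c"
  have "map_pmf fst ?c = map_pmf ?s (map_pmf fst c)" "map_pmf snd ?c = map_pmf ?s (map_pmf snd c)"
    by (auto simp: map_pmf_comp)
  then have "map_pmf fst ?c = p" "map_pmf snd ?c = q"
    using sign_pmf_eq_bernoulli(1)[OF assms(1)] sign_pmf_eq_bernoulli(1)[OF assms(2)] c by auto
  moreover have "map_prod ?s ?s -` {z. fst z \<noteq> snd z} = {z. fst z \<noteq> snd z}"
    by (auto simp: vimage_def)
  then have "measure_pmf.prob ?c {z. fst z \<noteq> snd z} = \<bar>pmf p 1 - pmf q 1\<bar>"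
    using c(3) by simp
  ultimately show ?thesis
    using sign_pmf_eq_bernoulli(2)[OF assms(1)] sign_pmf_eq_bernoulli(2)[OF assms(2)]
    by (intro exI[of _ ?c]) (auto simp: abs_if)
qed

text \<open>Conditioning on the first \<open>k\<close> coordinates becomes conditioning on the value
  of \<open>trunc k\<close>. Padding with 0 agrees with the convention of \<open>cube\<close> and
  with the default value used in \<open>Pi_pmf\<close>.\<close>

definition trunc :: "nat \<Rightarrow> (nat \<Rightarrow> real) \<Rightarrow> nat \<Rightarrow> real" where
  "trunc k y = (\<lambda>i. if i < k then y i else 0)"

lemma trunc_Suc: "trunc (Suc k) y = (trunc k y)(k := y k)"
  by (auto simp: trunc_def fun_eq_iff less_Suc_eq)

lemma trunc_cube: "y \<in> cube n \<Longrightarrow> trunc n y = y"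
  by (auto simp: trunc_def cube_def fun_eq_iff)

section \<open>Disintegration along the fibres of a map\<close>

lemma expectation_cond_pmf:
  fixes h :: "'a \<Rightarrow> real"
  assumes "finite (set_pmf p)" "set_pmf p \<inter> S \<noteq> {}"
  shows "measure_pmf.expectation (cond_pmf p S) h =
         measure_pmf.expectation p (\<lambda>y. h y * indicator S y) / measure_pmf.prob p S"
proof -
  have "measure_pmf.expectation (cond_pmf p S) h =
        (\<Sum>y\<in>set_pmf p. h y * pmf (cond_pmf p S) y)"
    by (rule integral_measure_pmf_real) (use assms in \<open>auto simp: set_cond_pmf\<close>)
  also have "\<dots> = (\<Sum>y\<in>set_pmf p. (h y * indicator S y) * pmf p y) / measure_pmf.prob p S"
    unfolding sum_divide_distrib
    by (rule sum.cong) (use assms in \<open>auto simp: pmf_cond indicator_def\<close>)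
  also have "(\<Sum>y\<in>set_pmf p. (h y * indicator S y) * pmf p y) =
      measure_pmf.expectation p (\<lambda>y. h y * indicator S y)"
    by (rule integral_measure_pmf_real[symmetric]) (use assms in auto)
  finally show ?thesis .
qed

text \<open>Law of total probability: draw the value of \<open>T\<close> first, then a point from
  the conditional law on its fibre.\<close>

lemma bind_cond_fibres:
  "bind_pmf (map_pmf T p) (\<lambda>x. cond_pmf p {y. T y = x}) = p"
proof (rule bind_cond_pmf_cancel[where R = "\<lambda>x y. T y = x"])
  fix x y
  assume "x \<in> set_pmf (map_pmf T p)" "y \<in> set_pmf p" "T y = x"
  have "{a. T y = a} = {x}" using \<open>T y = x\<close> by auto
  then show "measure_pmf.prob p {y. T y = x} = measure_pmf.prob (map_pmf T p) {a. T y = a}"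
    by (simp add: vimage_def)
qed auto

text \<open>The tower property, read off from the disintegration of \<open>p\<close> into its
  fibres.\<close>

lemma expectation_cond_fibres:
  fixes h :: "'a \<Rightarrow> real"
  assumes "finite (set_pmf p)"
  shows "measure_pmf.expectation (map_pmf T p) (\<lambda>x. measure_pmf.expectation (cond_pmf p {y. T y = x}) h)
       = measure_pmf.expectation p h"
proof -
  have "measure_pmf.expectation p h =
      measure_pmf.expectation (bind_pmf (map_pmf T p) (\<lambda>x. cond_pmf p {y. T y = x})) h"
    by (simp add: bind_cond_fibres)
  also have "\<dots> = (\<Sum>x\<in>T ` set_pmf p. pmf (map_pmf T p) x *\<^sub>R
      measure_pmf.expectation (cond_pmf p {y. T y = x}) h)"
  proof (rule pmf_expectation_bind)
    fix x assume "x \<in> T ` set_pmf p"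
    then have "set_pmf p \<inter> {y. T y = x} \<noteq> {}" by auto
    then show "finite (set_pmf (cond_pmf p {y. T y = x}))"
      using assms by (simp add: set_cond_pmf)
  qed (use assms in auto)
  also have "\<dots> = measure_pmf.expectation (map_pmf T p)
      (\<lambda>x. measure_pmf.expectation (cond_pmf p {y. T y = x}) h)"
    by (rule integral_measure_pmf[symmetric]) (use assms in auto)
  finally show ?thesis by simp
qed

lemma hamming_fun_upd:
  "hamming (Suc k) (x(k := s)) (y(k := t)) = hamming k x y + (if s \<noteq> t then 1 else 0)"
proof -
  have "{i. i < Suc k \<and> (x(k := s)) i \<noteq> (y(k := t)) i} =
      {i. i < k \<and> x i \<noteq> y i} \<union> (if s \<noteq> t then {k} else {})"
    by (auto simp: less_Suc_eq)
  then show ?thesis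
    unfolding hamming_def by (auto simp: card_insert_if)
qed

text \<open>The coordinates are revealed one at a time: given the first \<open>k\<close> coordinates of both
  vectors, the \<open>k\<close>-th ones are coupled maximally, at a cost of half the difference of
  their conditional means.\<close>

lemma sequential_coupling:
  assumes supp: "set_pmf \<nu> \<subseteq> cube n"
    and b: "\<And>i. i < n \<Longrightarrow> set_pmf (b i) \<subseteq> {-1, 1}"
    and g: "\<And>i x. i < n \<Longrightarrow>
      measure_pmf.expectation \<nu> (\<lambda>y. y i * indicator {y. trunc i y = x} y) =
      measure_pmf.expectation \<nu> (\<lambda>y. g i y * indicator {y. trunc i y = x} y)"
    and "k \<le> n"
  shows "\<exists>c. map_pmf fst c = map_pmf (trunc k) \<nu> \<and> map_pmf snd c = Pi_pmf {..<k} 0 b \<and>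
    measure_pmf.expectation c (\<lambda>(x, y). hamming k x y) \<le>
      (\<Sum>i<k. measure_pmf.expectation \<nu> (\<lambda>y. \<bar>g i y - measure_pmf.expectation (b i) (\<lambda>x. x)\<bar>)) / 2"
  using \<open>k \<le> n\<close>
proof (induction k)
  case 0
  \<comment> \<open>Before any coordinate is revealed both vectors equal the default vector 0, so
    the trivial coupling costs nothing.\<close>
  have t0: "trunc 0 y = (\<lambda>_. 0)" for y by (simp add: trunc_def)
  show ?case
    by (rule exI[of _ "return_pmf (\<lambda>_. 0, \<lambda>_. 0)"]) (simp add: t0 hamming_def)
next
  case (Suc k)
  then have k: "k < n" by simp
  obtain c where c: "map_pmf fst c = map_pmf (trunc k) \<nu>" "map_pmf snd c = Pi_pmf {..<k} 0 b"
    and cost: "measure_pmf.expectation c (\<lambda>(x, y). hamming k x y) \<le>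
      (\<Sum>i<k. measure_pmf.expectation \<nu> (\<lambda>y. \<bar>g i y - measure_pmf.expectation (b i) (\<lambda>x. x)\<bar>)) / 2"
    using Suc by auto
  define m where "m = measure_pmf.expectation (b k) (\<lambda>x. x)"
  define C where "C x = cond_pmf \<nu> {y. trunc k y = x}" for x
  define P where "P x = map_pmf (\<lambda>y. y k) (C x)" for x
  have fin\<nu>: "finite (set_pmf \<nu>)"
    using supp finite_cube by (rule finite_subset)
  have setC: "set_pmf (C x) = set_pmf \<nu> \<inter> {y. trunc k y = x}" if "x \<in> trunc k ` set_pmf \<nu>" for x
    unfolding C_def by (rule set_cond_pmf) (use that in auto)
  have setP: "set_pmf (P x) \<subseteq> {-1, 1}" if "x \<in> trunc k ` set_pmf \<nu>" for x
    unfolding P_def using setC[OF that] supp k by (auto simp: cube_def)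
  \<comment> \<open>By the hypothesis on \<open>g\<close>, the functions \<open>y k\<close> and
    \<open>g k\<close> have the same integral over every fibre of \<open>trunc k\<close>, hence the
    same conditional mean.\<close>
  have EP: "measure_pmf.expectation (P x) (\<lambda>s. s) = measure_pmf.expectation (C x) (g k)"
    if "x \<in> trunc k ` set_pmf \<nu>" for x
  proof -
    have ne: "set_pmf \<nu> \<inter> {y. trunc k y = x} \<noteq> {}" using that by auto
    show ?thesis
      unfolding P_def C_def integral_map_pmf
      by (simp add: expectation_cond_pmf[OF fin\<nu> ne] g[OF k])
  qed
  \<comment> \<open>The guard restricts to values that \<open>trunc k\<close> attains on the
    support; elsewhere the fibre is null and \<open>cond_pmf\<close> says nothing.\<close>
  have "\<forall>x. \<exists>\<kappa>. x \<in> trunc k ` set_pmf \<nu> \<longrightarrow> map_pmf fst \<kappa> = P x \<and> map_pmf snd \<kappa> = b k \<and>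
    measure_pmf.prob \<kappa> {z. fst z \<noteq> snd z} = \<bar>measure_pmf.expectation (P x) (\<lambda>x. x) - m\<bar> / 2"
    unfolding m_def using sign_coupling[OF setP b[OF k]] by blast
  from choice[OF this] obtain \<kappa> where \<kappa>:
    "\<forall>x. x \<in> trunc k ` set_pmf \<nu> \<longrightarrow> map_pmf fst (\<kappa> x) = P x \<and> map_pmf snd (\<kappa> x) = b k \<and>
      measure_pmf.prob (\<kappa> x) {z. fst z \<noteq> snd z} = \<bar>measure_pmf.expectation (P x) (\<lambda>x. x) - m\<bar> / 2" ..
  have \<kappa>: "map_pmf fst (\<kappa> x) = P x" "map_pmf snd (\<kappa> x) = b k"
    "measure_pmf.prob (\<kappa> x) {z. fst z \<noteq> snd z} = \<bar>measure_pmf.expectation (P x) (\<lambda>x. x) - m\<bar> / 2"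
    if "x \<in> trunc k ` set_pmf \<nu>" for x
    using \<kappa> that by blast+
  have fstc: "fst z \<in> trunc k ` set_pmf \<nu>" if "z \<in> set_pmf c" for z
    using that arg_cong[OF c(1), of set_pmf] by auto
  \<comment> \<open>One step of the coupling: both partial vectors are extended at position
    \<open>k\<close> by a pair of signs whose joint law depends only on the past of the first
    vector.\<close>
  define F where "F z = map_pmf (\<lambda>w. ((fst z)(k := fst w), (snd z)(k := snd w))) (\<kappa> (fst z))"
    for z :: "(nat \<Rightarrow> real) \<times> (nat \<Rightarrow> real)"
  define c' where "c' = bind_pmf c F"
  have fst': "map_pmf fst c' = map_pmf (trunc (Suc k)) \<nu>"
  proof -
    have "map_pmf fst c' = bind_pmf c (\<lambda>z. map_pmf (\<lambda>s. (fst z)(k := s)) (P (fst z)))"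
      unfolding c'_def map_bind_pmf
    proof (rule bind_pmf_cong[OF refl])
      fix z assume z: "z \<in> set_pmf c"
      show "map_pmf fst (F z) = map_pmf (\<lambda>s. (fst z)(k := s)) (P (fst z))"
        unfolding \<kappa>(1)[OF fstc[OF z], symmetric] F_def by (simp add: map_pmf_comp)
    qed
    also have "\<dots> = bind_pmf (map_pmf fst c) (\<lambda>x. map_pmf (\<lambda>s. x(k := s)) (P x))"
      by (simp add: bind_map_pmf)
    also have "\<dots> = bind_pmf (map_pmf (trunc k) \<nu>) (\<lambda>x. map_pmf (trunc (Suc k)) (C x))"
      unfolding c(1)
    proof (rule bind_pmf_cong[OF refl])
      fix x assume "x \<in> set_pmf (map_pmf (trunc k) \<nu>)"
      then have x: "x \<in> trunc k ` set_pmf \<nu>" by simp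
      show "map_pmf (\<lambda>s. x(k := s)) (P x) = map_pmf (trunc (Suc k)) (C x)"
        unfolding P_def map_pmf_comp
        by (rule map_pmf_cong[OF refl]) (use setC[OF x] in \<open>auto simp: trunc_Suc\<close>)
    qed
    also have "\<dots> = map_pmf (trunc (Suc k)) \<nu>"
      unfolding map_bind_pmf[symmetric] C_def bind_cond_fibres ..
    finally show ?thesis .
  qed
  \<comment> \<open>The second marginal of the sign coupling is \<open>b k\<close> whatever the
    past, so the new coordinate is independent of the earlier ones and the second vector keeps its
    product law.\<close>
  have snd': "map_pmf snd c' = Pi_pmf {..<Suc k} 0 b"
  proof -
    have "map_pmf snd c' = bind_pmf c (\<lambda>z. map_pmf (\<lambda>t. (snd z)(k := t)) (b k))"
      unfolding c'_def map_bind_pmf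
    proof (rule bind_pmf_cong[OF refl])
      fix z assume z: "z \<in> set_pmf c"
      show "map_pmf snd (F z) = map_pmf (\<lambda>t. (snd z)(k := t)) (b k)"
        unfolding \<kappa>(2)[OF fstc[OF z], symmetric] F_def by (simp add: map_pmf_comp)
    qed
    also have "\<dots> = bind_pmf (map_pmf snd c) (\<lambda>y. map_pmf (\<lambda>t. y(k := t)) (b k))"
      by (simp add: bind_map_pmf)
    also have "\<dots> = Pi_pmf (insert k {..<k}) 0 b"
      unfolding c(2) unfolding map_pmf_def
      by (subst Pi_pmf_insert') (auto intro: bind_commute_pmf)
    finally show ?thesis by (simp add: lessThan_Suc)
  qed
  have finc: "finite (set_pmf c)"
  proof (rule finite_subset)
    have "finite (set_pmf (Pi_pmf {..<k} 0 b))"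
      unfolding set_Pi_pmf[OF finite_lessThan]
      by (rule finite_PiE_dflt) (use k in \<open>auto intro!: finite_subset[OF b]\<close>)
    then have "finite (set_pmf (map_pmf snd c))" unfolding c(2) .
    moreover have "finite (set_pmf (map_pmf fst c))"
      unfolding c(1) using fin\<nu> by simp
    ultimately show "finite (fst ` set_pmf c \<times> snd ` set_pmf c)" by simp
    show "set_pmf c \<subseteq> fst ` set_pmf c \<times> snd ` set_pmf c"
      by (rule subset_fst_snd)
  qed
  have fin\<kappa>: "finite (set_pmf (\<kappa> x))" if x: "x \<in> trunc k ` set_pmf \<nu>" for x
  proof (rule finite_subset)
    show "set_pmf (\<kappa> x) \<subseteq> {-1, 1} \<times> {-1, 1}"
      using setP[OF x] b[OF k] unfolding \<kappa>(1)[OF x, symmetric] \<kappa>(2)[OF x, symmetric] set_map_pmf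
      by (rule order_trans[OF subset_fst_snd Sigma_mono])
  qed auto
  have EF: "measure_pmf.expectation (F z) (\<lambda>(x, y). hamming (Suc k) x y) =
      hamming k (fst z) (snd z) + \<bar>measure_pmf.expectation (C (fst z)) (g k) - m\<bar> / 2"
    if z: "z \<in> set_pmf c" for z
  proof -
    have "measure_pmf.expectation (F z) (\<lambda>(x, y). hamming (Suc k) x y) =
      measure_pmf.expectation (\<kappa> (fst z))
        (\<lambda>w. hamming k (fst z) (snd z) + indicator {w. fst w \<noteq> snd w} w)"
      unfolding F_def integral_map_pmf
      by (rule Bochner_Integration.integral_cong) (auto simp: hamming_fun_upd)
    also have "\<dots> = hamming k (fst z) (snd z) + measure_pmf.prob (\<kappa> (fst z)) {w. fst w \<noteq> snd w}"
      by (subst Bochner_Integration.integral_add)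
         (auto intro!: integrable_measure_pmf_finite fin\<kappa>[OF fstc[OF z]])
    finally show ?thesis
      by (simp add: \<kappa>(3)[OF fstc[OF z]] EP[OF fstc[OF z]])
  qed
  have "measure_pmf.expectation c' (\<lambda>(x, y). hamming (Suc k) x y) =
      (\<Sum>z\<in>set_pmf c. pmf c z *\<^sub>R measure_pmf.expectation (F z) (\<lambda>(x, y). hamming (Suc k) x y))"
    unfolding c'_def
    by (rule pmf_expectation_bind) (use finc fin\<kappa> fstc in \<open>auto simp: F_def\<close>)
  also have "\<dots> = (\<Sum>z\<in>set_pmf c. pmf c z *\<^sub>R (hamming k (fst z) (snd z)
      + \<bar>measure_pmf.expectation (C (fst z)) (g k) - m\<bar> / 2))"
    by (rule sum.cong) (auto simp: EF)
  also have "\<dots> = measure_pmf.expectation c (\<lambda>z. hamming k (fst z) (snd z)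
      + \<bar>measure_pmf.expectation (C (fst z)) (g k) - m\<bar> / 2)"
    by (rule integral_measure_pmf[symmetric]) (use finc in auto)
  also have "\<dots> = measure_pmf.expectation c (\<lambda>(x, y). hamming k x y)
      + measure_pmf.expectation c (\<lambda>z. \<bar>measure_pmf.expectation (C (fst z)) (g k) - m\<bar>) / 2"
    by (subst Bochner_Integration.integral_add)
       (auto intro!: integrable_measure_pmf_finite finc simp: case_prod_unfold)
  also have "measure_pmf.expectation c (\<lambda>z. \<bar>measure_pmf.expectation (C (fst z)) (g k) - m\<bar>)
      = measure_pmf.expectation (map_pmf (trunc k) \<nu>) (\<lambda>x. \<bar>measure_pmf.expectation (C x) (g k) - m\<bar>)"
    unfolding c(1)[symmetric] by simp
  \<comment> \<open>Jensen on each fibre moves the absolute value inside the conditional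
    expectation; the tower property then removes the conditioning.\<close>
  also have "\<dots> \<le> measure_pmf.expectation (map_pmf (trunc k) \<nu>)
      (\<lambda>x. measure_pmf.expectation (C x) (\<lambda>y. \<bar>g k y - m\<bar>))"
  proof (rule integral_mono_AE)
    show "AE x in map_pmf (trunc k) \<nu>. \<bar>measure_pmf.expectation (C x) (g k) - m\<bar>
        \<le> measure_pmf.expectation (C x) (\<lambda>y. \<bar>g k y - m\<bar>)"
    proof (rule AE_pmfI)
      fix x assume "x \<in> set_pmf (map_pmf (trunc k) \<nu>)"
      then have "finite (set_pmf (C x))" using setC fin\<nu> by auto
      then have "measure_pmf.expectation (C x) (g k) - m = measure_pmf.expectation (C x) (\<lambda>y. g k y - m)"
        by (subst Bochner_Integration.integral_diff) (auto intro!: integrable_measure_pmf_finite)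
      then show "\<bar>measure_pmf.expectation (C x) (g k) - m\<bar>
        \<le> measure_pmf.expectation (C x) (\<lambda>y. \<bar>g k y - m\<bar>)"
        using integral_abs_bound by metis
    qed
  qed (use fin\<nu> in \<open>auto intro!: integrable_measure_pmf_finite\<close>)
  also have "\<dots> = measure_pmf.expectation \<nu> (\<lambda>y. \<bar>g k y - m\<bar>)"
    unfolding C_def by (rule expectation_cond_fibres[OF fin\<nu>])
  finally have "measure_pmf.expectation c' (\<lambda>(x, y). hamming (Suc k) x y) \<le>
      (\<Sum>i<Suc k. measure_pmf.expectation \<nu> (\<lambda>y. \<bar>g i y - measure_pmf.expectation (b i) (\<lambda>x. x)\<bar>)) / 2"
    using cost by (simp add: m_def add_divide_distrib)
  then show ?case using fst' snd' by blast
qed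

section \<open>Transport distance to a product measure\<close>

lemma W1_le_coupling:
  assumes "map_pmf fst c = \<nu>1" "map_pmf snd c = \<nu>2"
  shows "W1 n \<nu>1 \<nu>2 \<le> measure_pmf.expectation c (\<lambda>(x, y). hamming n x y)"
  unfolding W1_def
proof (rule cInf_lower)
  show "bdd_below {measure_pmf.expectation c (\<lambda>(x, y). hamming n x y) |c.
        map_pmf fst c = \<nu>1 \<and> map_pmf snd c = \<nu>2}"
    by (rule bdd_belowI[of _ 0]) (auto intro!: Bochner_Integration.integral_nonneg simp: hamming_def)
qed (use assms in auto)

text \<open>Rebuilds a product measure from its one-dimensional marginals, in the
  \<open>Pi_pmf\<close> form that the sequential coupling produces.\<close>

lemma product_on_cube_eq_Pi_pmf:
  assumes "product_on_cube n \<xi>"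
  shows "\<xi> = Pi_pmf {..<n} 0 (\<lambda>i. map_pmf (\<lambda>z. z i) \<xi>)" (is "_ = ?P")
    and "i < n \<Longrightarrow> set_pmf (map_pmf (\<lambda>z. z i) \<xi>) \<subseteq> {-1, 1}"
proof -
  have supp: "set_pmf \<xi> \<subseteq> cube n" and prod: "\<And>y. y \<in> cube n \<Longrightarrow>
      pmf \<xi> y = (\<Prod>i<n. pmf (map_pmf (\<lambda>z. z i) \<xi>) (y i))"
    using assms by (auto simp: product_on_cube_def)
  show sub: "set_pmf (map_pmf (\<lambda>z. z i) \<xi>) \<subseteq> {-1, 1}" if "i < n" for i
    using supp that by (auto simp: cube_def)
  show "\<xi> = ?P"
  proof (rule pmf_eqI)
    fix y
    show "pmf \<xi> y = pmf ?P y"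
    proof (cases "y \<in> cube n")
      case True
      then show ?thesis
        unfolding prod[OF True] by (subst pmf_Pi') (auto simp: cube_def)
    next
      case False
      have "set_pmf ?P \<subseteq> cube n"
      proof
        fix x assume "x \<in> set_pmf ?P"
        then have "x \<in> PiE_dflt {..<n} 0 (set_pmf \<circ> (\<lambda>i. map_pmf (\<lambda>z. z i) \<xi>))"
          by (subst (asm) set_Pi_pmf) auto
        then have x: "\<And>i. i < n \<Longrightarrow> x i \<in> set_pmf (map_pmf (\<lambda>z. z i) \<xi>)" "\<And>i. n \<le> i \<Longrightarrow> x i = 0"
          unfolding PiE_dflt_def by auto
        show "x \<in> cube n"
          unfolding cube_def using subsetD[OF sub x(1)] x(2) by auto
      qed
      then have "y \<notin> set_pmf ?P" "y \<notin> set_pmf \<xi>"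
        using False supp by blast+
      then show ?thesis by (metis pmf_eq_0_set_pmf)
    qed
  qed
qed

text \<open>The sequential coupling run through all \<open>n\<close> coordinates, with the marginals
  of \<open>\<xi>\<close> as target signs; \<open>trunc n\<close> is the identity on the
  support.\<close>

lemma W1_product_le:
  assumes supp: "set_pmf \<nu> \<subseteq> cube n"
    and g: "\<And>i x. i < n \<Longrightarrow>
      measure_pmf.expectation \<nu> (\<lambda>y. y i * indicator {y. trunc i y = x} y) =
      measure_pmf.expectation \<nu> (\<lambda>y. g i y * indicator {y. trunc i y = x} y)"
    and \<xi>: "product_on_cube n \<xi>"
  shows "W1 n \<nu> \<xi> \<le>
    (\<Sum>i<n. measure_pmf.expectation \<nu> (\<lambda>y. \<bar>g i y - measure_pmf.expectation \<xi> (\<lambda>y. y i)\<bar>)) / 2"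
proof -
  let ?b = "\<lambda>i. map_pmf (\<lambda>z. z i) \<xi>"
  obtain c where c: "map_pmf fst c = map_pmf (trunc n) \<nu>" "map_pmf snd c = Pi_pmf {..<n} 0 ?b"
    "measure_pmf.expectation c (\<lambda>(x, y). hamming n x y) \<le>
      (\<Sum>i<n. measure_pmf.expectation \<nu> (\<lambda>y. \<bar>g i y - measure_pmf.expectation (?b i) (\<lambda>x. x)\<bar>)) / 2"
    using sequential_coupling[where b = ?b and k = n and g = g, OF supp product_on_cube_eq_Pi_pmf(2)[OF \<xi>] g]
    by auto
  have "map_pmf (trunc n) \<nu> = \<nu>"
    by (rule map_pmf_idI) (use supp trunc_cube in auto)
  then have "W1 n \<nu> \<xi> \<le> measure_pmf.expectation c (\<lambda>(x, y). hamming n x y)"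
    using c(1,2) product_on_cube_eq_Pi_pmf(1)[OF \<xi>] by (intro W1_le_coupling) auto
  then show ?thesis using c(3) by simp
qed

text \<open>The marginal on the empty index set is the point mass at 0, so gluing over all of
  \<open>{..<n}\<close> changes nothing.\<close>

lemma glue_full:
  assumes "set_pmf \<xi> \<subseteq> cube n"
  shows "glue {..<n} \<xi> ({..<n} - {..<n}) \<nu> = \<xi>"
proof -
  have m: "marginal {..<n} \<xi> = \<xi>"
    unfolding marginal_def
    by (rule map_pmf_idI) (use assms in \<open>force simp: cube_def fun_eq_iff not_less\<close>)
  have "marginal {} \<nu> = return_pmf (\<lambda>_. 0)"
    unfolding marginal_def by (simp add: map_pmf_const)
  then have "glue {..<n} \<xi> ({..<n} - {..<n}) \<nu> =
      map_pmf (\<lambda>a i. if i < n then a i else 0) \<xi>"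
    unfolding glue_def m by (simp add: pair_return_pmf2 map_pmf_comp)
  also have "\<dots> = \<xi>"
    by (rule map_pmf_idI) (use assms in \<open>force simp: cube_def fun_eq_iff not_less\<close>)
  finally show ?thesis .
qed

subsection \<open>Exponential tilts\<close>

text \<open>Both tanh and \<open>x - tanh x\<close> are nondecreasing, so the increment of tanh has
  the sign of \<open>x - y\<close> and is no larger in absolute value.\<close>

lemma tanh_diff_sq_le: "(tanh x - tanh y)\<^sup>2 \<le> (tanh x - tanh y) * (x - y)" for x y :: real
proof -
  have le: "tanh b - tanh a \<le> b - a" if "a \<le> b" for a b :: real
  proof -
    have "mono (\<lambda>x::real. x - tanh x)"
    proof (rule monoI)
      fix a b :: real assume "a \<le> b"
      then show "a - tanh a \<le> b - tanh b"
        by (rule DERIV_nonneg_imp_nondecreasing)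
           (auto intro!: exI derivative_eq_intros simp: cosh_real_nonzero)
    qed
    then show ?thesis using monoD that by force
  qed
  show ?thesis
  proof (cases "x \<le> y")
    case True
    have "(tanh y - tanh x) * (tanh y - tanh x) \<le> (tanh y - tanh x) * (y - x)"
      using le[OF True] True by (intro mult_left_mono) auto
    then show ?thesis by (simp add: power2_eq_square algebra_simps)
  next
    case False
    then have "(tanh x - tanh y) * (tanh x - tanh y) \<le> (tanh x - tanh y) * (x - y)"
      using le[of y x] by (intro mult_left_mono) auto
    then show ?thesis by (simp add: power2_eq_square)
  qed
qed

text \<open>Lets integrals be compared with the Gaussian width of a finite set: the supremum is an
  iterated maximum of integrable functions.\<close>

lemma integrable_SUP_finite:
  fixes f :: "'a \<Rightarrow> 'b \<Rightarrow> real"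
  assumes "finite K" "K \<noteq> {}" "\<And>x. x \<in> K \<Longrightarrow> integrable M (f x)"
  shows "integrable M (\<lambda>z. SUP x\<in>K. f x z)"
  using assms
proof (induction K rule: finite_ne_induct)
  case (insert x K)
  have "(\<lambda>z. SUP x\<in>insert x K. f x z) = (\<lambda>z. max (f x z) (SUP x\<in>K. f x z))"
    using insert.hyps by (subst cSUP_insert) (auto simp: sup_max)
  then show ?case using insert by (simp add: integrable_max)
qed simp

section \<open>Covariances under finitely supported laws\<close>

definition pmf_cov :: "'a pmf \<Rightarrow> ('a \<Rightarrow> real) \<Rightarrow> ('a \<Rightarrow> real) \<Rightarrow> real" where
  "pmf_cov p h k = measure_pmf.expectation p (\<lambda>y. h y * k y)
     - measure_pmf.expectation p h * measure_pmf.expectation p k"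

text \<open>Expanding the product over two independent copies gives the covariance twice. In this
  form covariances can be compared pointwise in the increments.\<close>

lemma pmf_cov_symmetrized:
  assumes "finite (set_pmf p)"
  shows "2 * pmf_cov p h k =
    measure_pmf.expectation p (\<lambda>x. measure_pmf.expectation p (\<lambda>y. (h x - h y) * (k x - k y)))"
proof -
  have int: "integrable (measure_pmf p) f" for f :: "_ \<Rightarrow> real"
    using assms by (rule integrable_measure_pmf_finite)
  show ?thesis
    by (simp add: pmf_cov_def algebra_simps int)
qed

lemma pmf_cov_self:
  assumes "finite (set_pmf p)"
  shows "pmf_cov p h h = measure_pmf.expectation p (\<lambda>y. (h y - measure_pmf.expectation p h)\<^sup>2)"
proof -
  have int: "integrable (measure_pmf p) f" for f :: "_ \<Rightarrow> real"
    using assms by (rule integrable_measure_pmf_finite)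
  show ?thesis
    by (simp add: pmf_cov_def power2_eq_square algebra_simps int)
qed

text \<open>The variance of the absolute value is nonnegative.\<close>

lemma expectation_abs_sq_le:
  fixes h :: "'a \<Rightarrow> real"
  assumes "finite (set_pmf p)"
  shows "(measure_pmf.expectation p (\<lambda>y. \<bar>h y\<bar>))\<^sup>2 \<le> measure_pmf.expectation p (\<lambda>y. (h y)\<^sup>2)"
proof -
  have "0 \<le> pmf_cov p (\<lambda>y. \<bar>h y\<bar>) (\<lambda>y. \<bar>h y\<bar>)"
    unfolding pmf_cov_self[OF assms] by (rule Bochner_Integration.integral_nonneg) simp
  then show ?thesis
    by (simp add: pmf_cov_def power2_eq_square flip: abs_mult)
qed

section \<open>The family of exponential tilts\<close>

locale positive_cube_pmf =
  fixes n :: nat and \<nu> :: "(nat \<Rightarrow> real) pmf"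
  assumes supp: "set_pmf \<nu> \<subseteq> cube n"
    and pos: "\<forall>y\<in>cube n. pmf \<nu> y > 0"
begin

definition weight :: "(nat \<Rightarrow> real) \<Rightarrow> (nat \<Rightarrow> real) \<Rightarrow> real" where
  "weight \<theta> y = pmf \<nu> y * exp (\<Sum>i<n. \<theta> i * y i)"

definition partition_fun :: "(nat \<Rightarrow> real) \<Rightarrow> real" where
  "partition_fun \<theta> = (\<Sum>y\<in>cube n. weight \<theta> y)"

definition tilt :: "(nat \<Rightarrow> real) \<Rightarrow> (nat \<Rightarrow> real) pmf" where
  "tilt \<theta> = embed_pmf (\<lambda>y. if y \<in> cube n then weight \<theta> y / partition_fun \<theta> else 0)"

lemma weight_pos: "y \<in> cube n \<Longrightarrow> weight \<theta> y > 0"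
  using pos by (simp add: weight_def)

lemma partition_fun_pos: "partition_fun \<theta> > 0"
  unfolding partition_fun_def by (intro sum_pos finite_cube cube_nonempty weight_pos)

lemma pmf_tilt: "pmf (tilt \<theta>) y = (if y \<in> cube n then weight \<theta> y / partition_fun \<theta> else 0)"
  unfolding tilt_def
proof (rule pmf_embed_pmf)
  let ?q = "\<lambda>y. if y \<in> cube n then weight \<theta> y / partition_fun \<theta> else 0"
  show nn: "0 \<le> ?q y" for y
    using weight_pos[of y \<theta>] partition_fun_pos[of \<theta>] by auto
  have "(\<integral>\<^sup>+ y. ennreal (?q y) \<partial>count_space UNIV) = (\<Sum>y\<in>cube n. ennreal (?q y))"
    by (rule nn_integral_count_space'[OF finite_cube]) auto
  also have "\<dots> = ennreal (\<Sum>y\<in>cube n. ?q y)"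
    by (rule sum_ennreal) (rule nn)
  also have "(\<Sum>y\<in>cube n. ?q y) = 1"
    using partition_fun_pos[of \<theta>] by (simp add: partition_fun_def flip: sum_divide_distrib)
  finally show "(\<integral>\<^sup>+ y. ennreal (?q y) \<partial>count_space UNIV) = 1" by simp
qed

lemma pmf_tilt_pos: "y \<in> cube n \<Longrightarrow> pmf (tilt \<theta>) y > 0"
  using weight_pos partition_fun_pos by (simp add: pmf_tilt)

lemma set_tilt: "set_pmf (tilt \<theta>) = cube n"
  using pmf_tilt_pos[of _ \<theta>] by (force simp: set_pmf_eq pmf_tilt)

lemma finite_set_tilt: "finite (set_pmf (tilt \<theta>))"
  unfolding set_tilt by (rule finite_cube)

lemma integrable_tilt [simp]: "integrable (measure_pmf (tilt \<theta>)) (h :: _ \<Rightarrow> real)"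
  by (rule integrable_measure_pmf_finite) (rule finite_set_tilt)

lemma expectation_tilt:
  fixes h :: "(nat \<Rightarrow> real) \<Rightarrow> real"
  shows
  "measure_pmf.expectation (tilt \<theta>) h = (\<Sum>y\<in>cube n. weight \<theta> y * h y) / partition_fun \<theta>"
  by (subst expectation_cube[of _ n]) (auto simp: set_tilt pmf_tilt sum_divide_distrib)

text \<open>Crude, since it only uses that probabilities are at most 1, but uniform in
  \<open>\<theta>\<close>: this provides the bounded integrands for Gaussian integration by
  parts.\<close>

lemma expectation_tilt_bound:
  fixes h :: "(nat \<Rightarrow> real) \<Rightarrow> real"
  shows
  "\<bar>measure_pmf.expectation (tilt \<theta>) h\<bar> \<le> (\<Sum>y\<in>cube n. \<bar>h y\<bar>)"
proof -
  have "\<bar>measure_pmf.expectation (tilt \<theta>) h\<bar> \<le> (\<Sum>y\<in>cube n. \<bar>pmf (tilt \<theta>) y * h y\<bar>)"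
    by (subst expectation_cube[of _ n]) (auto simp: set_tilt intro: sum_abs)
  also have "\<dots> \<le> (\<Sum>y\<in>cube n. \<bar>h y\<bar>)"
    by (rule sum_mono) (simp add: abs_mult mult_left_le_one_le pmf_le_1)
  finally show ?thesis .
qed

lemma inner_bound:
  assumes "y \<in> cube n"
  shows "\<bar>\<Sum>i<n. \<theta> i * y i\<bar> \<le> (\<Sum>i<n. \<bar>\<theta> i\<bar>)"
proof -
  have "\<bar>\<Sum>i<n. \<theta> i * y i\<bar> \<le> (\<Sum>i<n. \<bar>\<theta> i * y i\<bar>)" by (rule sum_abs)
  also have "\<dots> = (\<Sum>i<n. \<bar>\<theta> i\<bar>)"
    by (rule sum.cong) (auto simp: abs_mult cube_abs[OF assms])
  finally show ?thesis .
qed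

text \<open>The log-densities differ by the linear form in \<open>\<theta>\<close> minus the
  logarithm of the partition function. On the cube the linear form is at most the sum of the
  absolute values of \<open>\<theta>\<close>, and the partition function is an average of its
  exponential, so each term contributes this sum once.\<close>

lemma log_density_tilt:
  assumes y: "y \<in> cube n"
  shows "\<bar>log_density n \<nu> y - log_density n (tilt \<theta>) y\<bar> \<le> 2 * (\<Sum>i<n. \<bar>\<theta> i\<bar>)"
proof -
  let ?T = "\<Sum>i<n. \<bar>\<theta> i\<bar>" and ?L = "\<Sum>i<n. \<theta> i * y i"
  have u: "pmf (unif_cube n) y > 0"
    unfolding unif_cube_def using y
    by (subst pmf_of_set[OF cube_nonempty finite_cube]) (auto simp: card_cube)
  have p: "pmf \<nu> y > 0" using pos y by auto
  have "log_density n (tilt \<theta>) y = log_density n \<nu> y + ?L - ln (partition_fun \<theta>)"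
    unfolding log_density_def pmf_tilt weight_def
    using y u p partition_fun_pos[of \<theta>] by (simp add: ln_div ln_mult)
  moreover have "partition_fun \<theta> \<le> (\<Sum>y\<in>cube n. pmf \<nu> y * exp ?T)"
    unfolding partition_fun_def weight_def
  proof (rule sum_mono)
    fix y assume "y \<in> cube n"
    then show "pmf \<nu> y * exp (\<Sum>i<n. \<theta> i * y i) \<le> pmf \<nu> y * exp ?T"
      using inner_bound[of y \<theta>] by (intro mult_left_mono) auto
  qed
  moreover have "partition_fun \<theta> \<ge> (\<Sum>y\<in>cube n. pmf \<nu> y * exp (- ?T))"
    unfolding partition_fun_def weight_def
  proof (rule sum_mono)
    fix y assume "y \<in> cube n"
    then show "pmf \<nu> y * exp (\<Sum>i<n. \<theta> i * y i) \<ge> pmf \<nu> y * exp (- ?T)"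
      using inner_bound[of y \<theta>] by (intro mult_left_mono) auto
  qed
  ultimately have "log_density n (tilt \<theta>) y = log_density n \<nu> y + ?L - ln (partition_fun \<theta>)"
    "partition_fun \<theta> \<le> exp ?T" "partition_fun \<theta> \<ge> exp (- ?T)"
    using sum_pmf_cube[OF supp] by (auto simp flip: sum_distrib_right)
  moreover from this have "ln (partition_fun \<theta>) \<le> ?T" "- ?T \<le> ln (partition_fun \<theta>)"
    using partition_fun_pos[of \<theta>] ln_le_cancel_iff[of "partition_fun \<theta>" "exp ?T"]
      ln_le_cancel_iff[of "exp (- ?T)" "partition_fun \<theta>"] by auto
  ultimately show ?thesis using inner_bound[OF y, of \<theta>] by linarith
qed

section \<open>Conditional means of single coordinates under the tilt\<close>

abbreviation drift :: "nat \<Rightarrow> (nat \<Rightarrow> real) \<Rightarrow> real" where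
  "drift i y \<equiv> dpartial (log_density n \<nu>) i y"

lemma drift_fun_upd [simp]: "drift i (y(i := t)) = drift i y"
  by (simp add: dpartial_def)

text \<open>The derivative of the log-density of the tilt is \<open>drift i y + \<theta> i\<close>,
  which is half the logarithm of the ratio of the two weights; the uniform density cancels.\<close>

lemma weight_flip:
  assumes y: "y \<in> cube n" and i: "i < n"
  shows "weight \<theta> (y(i := -1)) = weight \<theta> (y(i := 1)) * exp (- 2 * (drift i y + \<theta> i))"
proof -
  have u: "pmf (unif_cube n) z = 1 / 2 ^ n" if "z \<in> cube n" for z
    unfolding unif_cube_def using that
    by (subst pmf_of_set[OF cube_nonempty finite_cube]) (auto simp: card_cube)
  have c: "y(i := 1) \<in> cube n" "y(i := -1) \<in> cube n"
    using cube_fun_upd[OF y i] by auto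
  let ?p = "pmf \<nu> (y(i := 1))" and ?m = "pmf \<nu> (y(i := -1))"
  have pm: "?p > 0" "?m > 0" using pos c by auto
  have d: "2 * drift i y = ln ?p - ln ?m"
    unfolding dpartial_def log_density_def u[OF c(1)] u[OF c(2)]
    using pm by (simp add: ln_div ln_mult)
  have s: "(\<Sum>j<n. \<theta> j * (y(i := s)) j) = (\<Sum>j\<in>{..<n} - {i}. \<theta> j * y j) + \<theta> i * s" for s
    using i by (subst sum.remove[of _ i]) (auto intro!: sum.cong)
  have "- 2 * (drift i y + \<theta> i) = (ln ?m - ln ?p) + (- 2 * \<theta> i)"
    using d by simp
  then have e: "exp (- 2 * (drift i y + \<theta> i)) = ?m / ?p * exp (- 2 * \<theta> i)"
    using pm by (simp only: exp_add exp_diff exp_ln)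
  show ?thesis
    unfolding weight_def s e using pm by (simp flip: exp_add)
qed

text \<open>Given the other coordinates, the signs 1 and -1 have weights proportional to 1 and
  \<open>E = exp (- 2 * (drift i y + \<theta> i))\<close>, so the conditional mean is
  \<open>(1 - E) / (1 + E)\<close>, a hyperbolic tangent. The test function \<open>h\<close> ranges
  over functions of the other coordinates.\<close>

lemma expectation_coordinate:
  assumes i: "i < n" and h: "\<And>y t. h (y(i := t)) = h y"
  shows "measure_pmf.expectation (tilt \<theta>) (\<lambda>y. y i * h y) =
         measure_pmf.expectation (tilt \<theta>) (\<lambda>y. tanh (drift i y + \<theta> i) * h y)"
proof -
  define F where "F y = weight \<theta> y * ((y i - tanh (drift i y + \<theta> i)) * h y)" for y
  define fl where "fl y = y(i := - y i)" for y :: "nat \<Rightarrow> real"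
  have sign: "y i = 1 \<or> y i = -1" if "y \<in> cube n" for y
    using that i by (auto simp: cube_def)
  have "fl y \<in> cube n" if "y \<in> cube n" for y
    unfolding fl_def using sign[OF that] by (intro cube_fun_upd[OF that i]) auto
  then have bij: "bij_betw fl (cube n) (cube n)"
    by (intro bij_betwI[of _ _ _ fl]) (auto simp: fl_def)
  have cancel: "F (y(i := 1)) + F (y(i := -1)) = 0" if y: "y \<in> cube n" for y
  proof -
    define E where "E = exp (- 2 * (drift i y + \<theta> i))"
    have E: "E > 0" by (simp add: E_def)
    have T: "tanh (drift i y + \<theta> i) = (1 - E) / (1 + E)"
      unfolding E_def by (rule tanh_real_altdef)
    have "F (y(i := 1)) + F (y(i := -1)) =
        weight \<theta> (y(i := 1)) * h y * ((1 - (1 - E) / (1 + E)) + E * (- 1 - (1 - E) / (1 + E)))"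
      unfolding F_def weight_flip[OF y i] h drift_fun_upd T fun_upd_same E_def[symmetric]
      by (simp add: algebra_simps)
    also have "(1 - (1 - E) / (1 + E)) + E * (- 1 - (1 - E) / (1 + E)) = 0"
      using E by (simp add: field_simps)
    finally show ?thesis by (simp only: mult_zero_right)
  qed
  have pair: "F y + F (fl y) = 0" if y: "y \<in> cube n" for y
  proof -
    have "(y = y(i := 1) \<and> fl y = y(i := -1)) \<or> (y = y(i := -1) \<and> fl y = y(i := 1))"
      using sign[OF y] by (auto simp: fl_def fun_eq_iff)
    then show ?thesis using cancel[OF y] by (metis add.commute)
  qed
  \<comment> \<open>Flipping coordinate \<open>i\<close> is an involution of the cube, so twice the
    sum is a sum over flipped pairs, each of which cancels.\<close>
  have "(\<Sum>y\<in>cube n. F y) + (\<Sum>y\<in>cube n. F y) = (\<Sum>y\<in>cube n. F y) + (\<Sum>y\<in>cube n. F (fl y))"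
    using sum.reindex_bij_betw[OF bij, of F] by simp
  also have "\<dots> = 0"
    using pair by (simp flip: sum.distrib)
  finally have "(\<Sum>y\<in>cube n. F y) = 0" by simp
  then have "(\<Sum>y\<in>cube n. weight \<theta> y * (y i * h y)) =
      (\<Sum>y\<in>cube n. weight \<theta> y * (tanh (drift i y + \<theta> i) * h y))"
    by (simp add: F_def algebra_simps sum_subtractf)
  then show ?thesis by (simp add: expectation_tilt)
qed

text \<open>As \<open>drift i\<close> ignores coordinate \<open>i\<close>, \<open>y i\<close> may be
  replaced by its conditional mean. After symmetrization \<open>\<theta> i\<close> drops out of the
  increments, and the inequality for tanh applies pointwise.\<close>

lemma cov_coordinate_drift:
  assumes i: "i < n"
  shows "pmf_cov (tilt \<theta>) (\<lambda>y. y i) (drift i) \<ge>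
    pmf_cov (tilt \<theta>) (\<lambda>y. tanh (drift i y + \<theta> i)) (\<lambda>y. tanh (drift i y + \<theta> i))"
proof -
  let ?g = "\<lambda>y. tanh (drift i y + \<theta> i)"
  have 1: "pmf_cov (tilt \<theta>) (\<lambda>y. y i) (drift i) = pmf_cov (tilt \<theta>) ?g (drift i)"
    unfolding pmf_cov_def
    using expectation_coordinate[OF i, of "drift i" \<theta>] expectation_coordinate[OF i, of "\<lambda>_. 1" \<theta>]
    by simp
  have "2 * pmf_cov (tilt \<theta>) ?g ?g \<le> 2 * pmf_cov (tilt \<theta>) ?g (drift i)"
    unfolding pmf_cov_symmetrized[OF finite_set_tilt]
  proof (intro integral_mono integrable_tilt)
    fix x y
    show "(?g x - ?g y) * (?g x - ?g y) \<le> (?g x - ?g y) * (drift i x - drift i y)"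
      using tanh_diff_sq_le[of "drift i x + \<theta> i" "drift i y + \<theta> i"]
      by (simp add: power2_eq_square)
  qed
  then show ?thesis using 1 by simp
qed

lemma pmf_cov_tilt_nonneg:
  assumes "i < n"
  shows "0 \<le> pmf_cov (tilt \<theta>) (\<lambda>y. y i) (drift i)"
  using cov_coordinate_drift[OF assms, of \<theta>]
  by (rule order_trans[rotated])
     (auto simp: pmf_cov_self[OF finite_set_tilt] intro: Bochner_Integration.integral_nonneg)

lemma W1_tilt_le:
  assumes \<xi>: "product_on_cube n \<xi>"
    and mean: "\<And>i. i < n \<Longrightarrow>
      measure_pmf.expectation \<xi> (\<lambda>y. y i) = measure_pmf.expectation (tilt \<theta>) (\<lambda>y. y i)"
  shows "W1 n (tilt \<theta>) \<xi> \<le> sqrt (n * (\<Sum>i<n. pmf_cov (tilt \<theta>) (\<lambda>y. y i) (drift i))) / 2"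
proof -
  let ?g = "\<lambda>i y. tanh (drift i y + \<theta> i)"
  let ?E = "\<lambda>i. measure_pmf.expectation (tilt \<theta>) (\<lambda>y. \<bar>?g i y - measure_pmf.expectation \<xi> (\<lambda>y. y i)\<bar>)"
  have W: "W1 n (tilt \<theta>) \<xi> \<le> (\<Sum>i<n. ?E i) / 2"
  proof (rule W1_product_le[OF _ _ \<xi>])
    fix i x assume i: "i < n"
    \<comment> \<open>\<open>trunc i\<close> keeps only the coordinates below \<open>i\<close>, so
      the indicator of its fibre is an admissible test function.\<close>
    have "trunc i (y(i := t)) = trunc i y" for y t
      by (auto simp: trunc_def)
    then show "measure_pmf.expectation (tilt \<theta>) (\<lambda>y. y i * indicator {y. trunc i y = x} y) =
        measure_pmf.expectation (tilt \<theta>) (\<lambda>y. ?g i y * indicator {y. trunc i y = x} y)"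
      by (intro expectation_coordinate[OF i]) (simp add: indicator_def)
  qed (simp add: set_tilt)
  have sq: "(?E i)\<^sup>2 \<le> pmf_cov (tilt \<theta>) (\<lambda>y. y i) (drift i)" if i: "i < n" for i
  proof -
    \<comment> \<open>Equality of means makes \<open>?E i\<close> the mean absolute deviation of
      \<open>?g i\<close>, hence at most its standard deviation.\<close>
    have "measure_pmf.expectation \<xi> (\<lambda>y. y i) = measure_pmf.expectation (tilt \<theta>) (?g i)"
      using expectation_coordinate[OF i, of "\<lambda>_. 1" \<theta>] mean[OF i] by simp
    then have "(?E i)\<^sup>2 \<le> pmf_cov (tilt \<theta>) (?g i) (?g i)"
      unfolding pmf_cov_self[OF finite_set_tilt]
      using expectation_abs_sq_le[OF finite_set_tilt] by metis
    then show ?thesis using cov_coordinate_drift[OF i, of \<theta>] by linarith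
  qed
  have "(\<Sum>i<n. ?E i)\<^sup>2 \<le> (\<Sum>i<n. (1::real)\<^sup>2) * (\<Sum>i<n. (?E i)\<^sup>2)"
    using Cauchy_Schwarz_ineq_sum[of "\<lambda>_. 1" ?E "{..<n}"] by simp
  also have "\<dots> \<le> n * (\<Sum>i<n. pmf_cov (tilt \<theta>) (\<lambda>y. y i) (drift i))"
    using sq by (auto intro!: mult_left_mono sum_mono)
  finally have "(\<Sum>i<n. ?E i) \<le> sqrt (n * (\<Sum>i<n. pmf_cov (tilt \<theta>) (\<lambda>y. y i) (drift i)))"
    by (rule real_le_rsqrt)
  then show ?thesis using W by simp
qed

section \<open>Differentiation and integration in the tilt parameter\<close>

lemma deriv_expectation_tilt:
  fixes \<sigma> :: real
  assumes i: "i < n"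
  shows "((\<lambda>t. measure_pmf.expectation (tilt (\<lambda>j. \<sigma> * (z(i := t)) j)) h) has_real_derivative
    \<sigma> * pmf_cov (tilt (\<lambda>j. \<sigma> * (z(i := t)) j)) (\<lambda>y. y i) h) (at t)"
proof -
  let ?\<theta> = "\<lambda>t j. \<sigma> * (z(i := t)) j"
  have s: "(\<Sum>j<n. ?\<theta> t j * y j) = (\<Sum>j\<in>{..<n} - {i}. \<sigma> * z j * y j) + \<sigma> * t * y i" for t y
    using i by (subst sum.remove[of _ i]) (auto intro!: sum.cong)
  have w: "((\<lambda>t. weight (?\<theta> t) y) has_real_derivative weight (?\<theta> t) y * (\<sigma> * y i)) (at t)" for y
    unfolding weight_def s by (auto intro!: derivative_eq_intros)
  have N: "((\<lambda>t. \<Sum>y\<in>cube n. weight (?\<theta> t) y * k y) has_real_derivative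
      (\<Sum>y\<in>cube n. weight (?\<theta> t) y * (\<sigma> * y i) * k y)) (at t)" for k
    by (intro DERIV_sum DERIV_cmult_right w)
  have P: "((\<lambda>t. partition_fun (?\<theta> t)) has_real_derivative
      (\<Sum>y\<in>cube n. weight (?\<theta> t) y * (\<sigma> * y i))) (at t)"
    unfolding partition_fun_def by (intro DERIV_sum w)
  have ne: "partition_fun (?\<theta> t) \<noteq> 0" using partition_fun_pos[of "?\<theta> t"] by simp
  have e1: "(\<Sum>y\<in>cube n. weight (?\<theta> t) y * (\<sigma> * y i) * h y) =
      \<sigma> * (\<Sum>y\<in>cube n. weight (?\<theta> t) y * (y i * h y))"
    unfolding sum_distrib_left by (intro sum.cong) (simp_all only: mult_ac)
  have e2: "(\<Sum>y\<in>cube n. weight (?\<theta> t) y * (\<sigma> * y i)) =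
      \<sigma> * (\<Sum>y\<in>cube n. weight (?\<theta> t) y * y i)"
    unfolding sum_distrib_left by (intro sum.cong) (simp_all only: mult_ac)
  \<comment> \<open>The quotient rule, with \<open>p\<close> the partition function and
    \<open>a\<close>, \<open>b\<close>, \<open>c\<close> the weighted sums of
    \<open>y i * h y\<close>, \<open>h y\<close> and \<open>y i\<close>; the right side is
    \<open>\<sigma>\<close> times a covariance.\<close>
  have quot: "(\<sigma> * a * p - b * (\<sigma> * c)) / (p * p) = \<sigma> * (a / p - c / p * (b / p))"
    if "p \<noteq> 0" for a b c p :: real
    using that by (simp add: field_simps)
  show ?thesis
    unfolding expectation_tilt pmf_cov_def
    by (rule DERIV_cong[OF DERIV_divide[OF N P ne]], unfold e1 e2, rule quot[OF ne])
qed

lemma expectation_tilt_measurable: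
  fixes \<sigma> :: real and h :: "(nat \<Rightarrow> real) \<Rightarrow> real"
  shows "(\<lambda>z. measure_pmf.expectation (tilt (\<lambda>j. \<sigma> * z j)) h) \<in> borel_measurable (gauss n)"
proof -
  have w: "(\<lambda>z. weight (\<lambda>j. \<sigma> * z j) y) \<in> borel_measurable (gauss n)" for y
    unfolding weight_def
    by (intro borel_measurable_times borel_measurable_const measurable_compose[OF _ borel_measurable_exp]
        borel_measurable_sum gauss_component_measurable) auto
  show ?thesis
    unfolding expectation_tilt partition_fun_def
    by (intro borel_measurable_divide borel_measurable_sum borel_measurable_times borel_measurable_const w)
qed

lemma pmf_cov_tilt_measurable:
  fixes \<sigma> :: real
  shows "(\<lambda>z. pmf_cov (tilt (\<lambda>j. \<sigma> * z j)) h k) \<in> borel_measurable (gauss n)"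
  unfolding pmf_cov_def
  by (intro borel_measurable_diff borel_measurable_times expectation_tilt_measurable)

lemma pmf_cov_tilt_bound:
  "\<bar>pmf_cov (tilt \<theta>) h k\<bar> \<le>
    (\<Sum>y\<in>cube n. \<bar>h y * k y\<bar>) + (\<Sum>y\<in>cube n. \<bar>h y\<bar>) * (\<Sum>y\<in>cube n. \<bar>k y\<bar>)"
proof -
  have "\<bar>pmf_cov (tilt \<theta>) h k\<bar> \<le> \<bar>measure_pmf.expectation (tilt \<theta>) (\<lambda>y. h y * k y)\<bar>
     + \<bar>measure_pmf.expectation (tilt \<theta>) h\<bar> * \<bar>measure_pmf.expectation (tilt \<theta>) k\<bar>"
    unfolding pmf_cov_def by (simp flip: abs_mult)
  also have "\<dots> \<le> (\<Sum>y\<in>cube n. \<bar>h y * k y\<bar>) + (\<Sum>y\<in>cube n. \<bar>h y\<bar>) * (\<Sum>y\<in>cube n. \<bar>k y\<bar>)"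
    by (intro add_mono mult_mono expectation_tilt_bound sum_nonneg) auto
  finally show ?thesis .
qed

lemma tilt_integration_by_parts:
  fixes \<sigma> :: real
  assumes i: "i < n"
  shows "(\<integral>z. z i * measure_pmf.expectation (tilt (\<lambda>j. \<sigma> * z j)) h \<partial>gauss n) =
    (\<integral>z. \<sigma> * pmf_cov (tilt (\<lambda>j. \<sigma> * z j)) (\<lambda>y. y i) h \<partial>gauss n)"
proof (rule gauss_integration_by_parts[OF i])
  show "isCont (\<lambda>t. \<sigma> * pmf_cov (tilt (\<lambda>j. \<sigma> * (z(i := t)) j)) (\<lambda>y. y i) h) t" for z t
    unfolding pmf_cov_def
    by (intro continuous_intros DERIV_isCont[OF deriv_expectation_tilt[OF i]])
  let ?B = "(\<Sum>y\<in>cube n. \<bar>y i * h y\<bar>) + (\<Sum>y\<in>cube n. \<bar>y i\<bar>) * (\<Sum>y\<in>cube n. \<bar>h y\<bar>)"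
  show "\<bar>\<sigma> * pmf_cov (tilt (\<lambda>j. \<sigma> * z j)) (\<lambda>y. y i) h\<bar> \<le> \<bar>\<sigma>\<bar> * ?B" for z
    by (subst abs_mult, intro mult_left_mono pmf_cov_tilt_bound) simp
  show "(\<lambda>z. \<sigma> * pmf_cov (tilt (\<lambda>j. \<sigma> * z j)) (\<lambda>y. y i) h) \<in> borel_measurable (gauss n)"
    by (intro borel_measurable_times borel_measurable_const pmf_cov_tilt_measurable)
qed (rule expectation_tilt_measurable deriv_expectation_tilt[OF i] expectation_tilt_bound)+

text \<open>Integration by parts turns the covariances into the pairing of \<open>z\<close> with the
  tilted mean of the gradient. For each fixed \<open>z\<close> this mean is a convex combination of
  discrete gradients, so the pairing is at most the supremum defining the Gaussian width.\<close>

lemma integral_cov_le_complexity: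
  fixes \<sigma> :: real
  shows "integrable (gauss n) (\<lambda>z. \<Sum>i<n. pmf_cov (tilt (\<lambda>j. \<sigma> * z j)) (\<lambda>y. y i) (drift i))"
      (is ?int)
    and "(\<integral>z. \<sigma> * (\<Sum>i<n. pmf_cov (tilt (\<lambda>j. \<sigma> * z j)) (\<lambda>y. y i) (drift i)) \<partial>gauss n)
      \<le> meas_complexity n \<nu>" (is ?le)
proof -
  let ?E = "\<lambda>z h. measure_pmf.expectation (tilt (\<lambda>j. \<sigma> * z j)) h"
  let ?C = "\<lambda>z i. pmf_cov (tilt (\<lambda>j. \<sigma> * z j)) (\<lambda>y. y i) (drift i)"
  have intC: "integrable (gauss n) (\<lambda>z. ?C z i)" for i
    by (rule integrable_gauss_bounded[OF pmf_cov_tilt_measurable pmf_cov_tilt_bound])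
  then show ?int by simp
  have intE: "integrable (gauss n) (\<lambda>z. z i * ?E z h)" if "i < n" for i h
    by (rule integrable_gauss_mult_component[OF that expectation_tilt_measurable expectation_tilt_bound])
  define K where "K = insert (\<lambda>_. 0) (dgrad n (log_density n \<nu>) ` cube n)"
  have K: "finite K" "K \<noteq> {}" by (auto simp: K_def finite_cube)
  have intK: "integrable (gauss n) (\<lambda>z. SUP x\<in>K. \<Sum>i<n. x i * z i)"
  proof (rule integrable_SUP_finite[OF K])
    fix x assume "x \<in> K"
    have "integrable (gauss n) (\<lambda>z. z i)" if "i < n" for i
      using integrable_gauss_mult_component[OF that, of "\<lambda>_. 1" 1] by simp
    then show "integrable (gauss n) (\<lambda>z. \<Sum>i<n. x i * z i)"
      by (intro Bochner_Integration.integrable_sum integrable_mult_right) auto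
  qed
  have "(\<integral>z. \<sigma> * (\<Sum>i<n. ?C z i) \<partial>gauss n) = (\<Sum>i<n. \<integral>z. \<sigma> * ?C z i \<partial>gauss n)"
    unfolding sum_distrib_left by (rule Bochner_Integration.integral_sum) (simp add: intC)
  also have "\<dots> = (\<Sum>i<n. \<integral>z. z i * ?E z (drift i) \<partial>gauss n)"
    by (rule sum.cong) (simp_all only: tilt_integration_by_parts lessThan_iff)
  also have "\<dots> = (\<integral>z. (\<Sum>i<n. z i * ?E z (drift i)) \<partial>gauss n)"
    by (rule Bochner_Integration.integral_sum[symmetric]) (simp add: intE)
  also have "\<dots> \<le> (\<integral>z. (SUP x\<in>K. \<Sum>i<n. x i * z i) \<partial>gauss n)"
  proof (rule integral_mono[OF _ intK])
    show "integrable (gauss n) (\<lambda>z. \<Sum>i<n. z i * ?E z (drift i))"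
      by (intro Bochner_Integration.integrable_sum intE) simp
    fix z
    have "(\<Sum>i<n. z i * ?E z (drift i)) = ?E z (\<lambda>y. \<Sum>i<n. drift i y * z i)"
      by (subst Bochner_Integration.integral_sum) (auto simp: mult.commute)
    also have "\<dots> \<le> ?E z (\<lambda>y. SUP x\<in>K. \<Sum>i<n. x i * z i)"
    proof (rule integral_mono_AE[OF integrable_tilt integrable_tilt], rule AE_pmfI)
      fix y assume "y \<in> set_pmf (tilt (\<lambda>j. \<sigma> * z j))"
      then have y: "dgrad n (log_density n \<nu>) y \<in> K" by (simp add: set_tilt K_def)
      have "(\<Sum>i<n. drift i y * z i) = (\<Sum>i<n. dgrad n (log_density n \<nu>) y i * z i)"
        by (rule sum.cong) (auto simp: dgrad_def)
      also have "\<dots> \<le> (SUP x\<in>K. \<Sum>i<n. x i * z i)"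
        using K by (intro cSUP_upper[OF y]) auto
      finally show "(\<Sum>i<n. drift i y * z i) \<le> (SUP x\<in>K. \<Sum>i<n. x i * z i)" .
    qed
    finally show "(\<Sum>i<n. z i * ?E z (drift i)) \<le> (SUP x\<in>K. \<Sum>i<n. x i * z i)" by simp
  qed
  finally show ?le
    unfolding meas_complexity_def grad_complexity_def gaussian_width_def K_def .
qed

text \<open>At \<open>\<sigma> = 0\<close> the left side of the preceding inequality
  vanishes.\<close>

lemma meas_complexity_nonneg: "0 \<le> meas_complexity n \<nu>"
  using integral_cov_le_complexity(2)[of 0] by simp

text \<open>First moment method for two nonnegative quantities \<open>S\<close> and \<open>N\<close>
  of mean at most \<open>D\<close> and \<open>n\<close>. If every \<open>z\<close> violated one of
  the bounds, \<open>n * S z + D * N z\<close> would exceed \<open>2 * (n * D)\<close> everywhere,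
  although its mean does not.\<close>

lemma exists_good_tilt:
  fixes \<sigma> :: real
  assumes \<sigma>: "\<sigma> > 0"
  shows "\<exists>z :: nat \<Rightarrow> real. (\<Sum>i<n. \<bar>z i\<bar>) \<le> 2 * real n \<and>
    \<sigma> * (\<Sum>i<n. pmf_cov (tilt (\<lambda>j. \<sigma> * z j)) (\<lambda>y. y i) (drift i)) \<le> 2 * meas_complexity n \<nu>"
proof (cases "n = 0")
  case True
  then show ?thesis using meas_complexity_nonneg by simp
next
  case False
  interpret G: prob_space "gauss n" by (rule prob_space_gauss)
  define S where "S z = \<sigma> * (\<Sum>i<n. pmf_cov (tilt (\<lambda>j. \<sigma> * z j)) (\<lambda>y. y i) (drift i))" for z
  define N where "N z = (\<Sum>i<n. \<bar>z i\<bar>)" for z :: "nat \<Rightarrow> real"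
  define D where "D = meas_complexity n \<nu>"
  have D: "0 \<le> D" unfolding D_def by (rule meas_complexity_nonneg)
  have S0: "0 \<le> S z" for z
    unfolding S_def using \<sigma> pmf_cov_tilt_nonneg by (intro mult_nonneg_nonneg sum_nonneg) auto
  have S: "integrable (gauss n) S" "(\<integral>z. S z \<partial>gauss n) \<le> D"
    unfolding S_def D_def using integral_cov_le_complexity[of \<sigma>]
    by (auto intro: integrable_mult_right)
  have N: "integrable (gauss n) N" "(\<integral>z. N z \<partial>gauss n) \<le> n"
  proof -
    show "integrable (gauss n) N"
      unfolding N_def by (intro Bochner_Integration.integrable_sum gauss_abs_component) simp
    have "(\<integral>z. N z \<partial>gauss n) = (\<Sum>i<n. \<integral>z. \<bar>z i\<bar> \<partial>gauss n)"
      unfolding N_def by (rule Bochner_Integration.integral_sum) (simp add: gauss_abs_component)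
    also have "\<dots> \<le> (\<Sum>i<n. 1)"
      by (rule sum_mono) (simp add: gauss_abs_component)
    finally show "(\<integral>z. N z \<partial>gauss n) \<le> n" by simp
  qed
  have "\<exists>z. N z \<le> 2 * real n \<and> S z \<le> 2 * D"
  proof (rule ccontr)
    assume neg: "\<not> ?thesis"
    show False
    \<comment> \<open>For \<open>D = 0\<close> the weighted sum no longer sees \<open>N\<close>.
      Instead \<open>S\<close> vanishes almost everywhere, which forces \<open>N\<close> above
      \<open>2 * n\<close> almost everywhere, against its mean.\<close>
    proof (cases "D = 0")
      case True
      have "(\<integral>z. S z \<partial>gauss n) = 0"
        using S(2) True S0 by (intro antisym Bochner_Integration.integral_nonneg) auto
      then have "AE z in gauss n. S z = 0"
        using integral_nonneg_eq_0_iff_AE[OF S(1)] S0 by simp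
      moreover have "2 * real n < N z" if "S z = 0" for z
        using neg True that by (auto simp: not_le)
      ultimately have "AE z in gauss n. 2 * real n < N z"
        by (auto elim: eventually_mono)
      then have "2 * real n < (\<integral>z. N z \<partial>gauss n)"
        by (intro G.expectation_greater N)
      then show False using N(2) by simp
    next
      case False
      then have D0: "D > 0" using D by simp
      have "2 * (n * D) < n * S z + D * N z" for z
      proof (cases "N z \<le> 2 * real n")
        case True
        then have "2 * D < S z" using neg by force
        then have "n * (2 * D) < n * S z" using \<open>n \<noteq> 0\<close> by simp
        moreover have "0 \<le> D * N z" using D by (simp add: N_def sum_nonneg)
        ultimately show ?thesis by simp
      next
        case False
        then have "D * (2 * n) < D * N z" using D0 by simp
        moreover have "0 \<le> n * S z" using S0 by simp
        ultimately show ?thesis by (simp add: mult_ac)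
      qed
      then have "2 * (n * D) < (\<integral>z. n * S z + D * N z \<partial>gauss n)"
        by (intro G.expectation_greater) (simp_all add: S N)
      also have "\<dots> = n * (\<integral>z. S z \<partial>gauss n) + D * (\<integral>z. N z \<partial>gauss n)"
        by (simp add: S N)
      also have "\<dots> \<le> n * D + D * n"
        by (intro add_mono mult_left_mono S N D) simp
      finally show False by simp
    qed
  qed
  then show ?thesis unfolding N_def S_def D_def .
qed

end

section \<open>Fixing the tilt, the constants and the index set\<close>

theorem theorem1p1:
  fixes n :: nat and \<nu> :: "(nat \<Rightarrow> real) pmf"
  assumes supp: "set_pmf \<nu> \<subseteq> cube n"
    and pos: "\<forall>y\<in>cube n. pmf \<nu> y > 0"
  shows "\<forall>\<epsilon>::real. 0 < \<epsilon> \<and> \<epsilon> < 1/16 \<longrightarrow>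
    (\<exists>\<nu>t :: (nat \<Rightarrow> real) pmf.
       set_pmf \<nu>t \<subseteq> cube n \<and> (\<forall>y\<in>cube n. pmf \<nu>t y > 0) \<and>
       (\<forall>y\<in>cube n. \<bar>log_density n \<nu> y - log_density n \<nu>t y\<bar> \<le> \<epsilon> * real n) \<and>
       (\<forall>\<xi>. product_on_cube n \<xi> \<and>
            (\<forall>i<n. measure_pmf.expectation \<xi> (\<lambda>y. y i) = measure_pmf.expectation \<nu>t (\<lambda>y. y i))
          \<longrightarrow> W1 n \<nu>t \<xi> \<le> 2^7 * sqrt (real n * meas_complexity n \<nu> / \<epsilon>)
                              + 4 * real n * exp (- 1 / (64 * \<epsilon>^2))
            \<and> (\<exists>I. I \<subseteq> {..<n} \<and>
                 real (card I) \<ge> real n - 2 * real n * exp (- 1 / (32 * \<epsilon>^2)) \<and>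
                 W1 n \<nu>t (glue I \<xi> ({..<n} - I) \<nu>t)
                   \<le> 2^6 * sqrt (real n * meas_complexity n \<nu> / \<epsilon>))))"
proof (intro allI impI, elim conjE)
  fix \<epsilon> :: real
  assume \<epsilon>: "0 < \<epsilon>"
  interpret positive_cube_pmf n \<nu> by standard (fact supp pos)+
  \<comment> \<open>With the absolute values of \<open>z\<close> summing to at most
    \<open>2 * n\<close>, the log-density moves by at most \<open>2 * \<sigma> * (2 * n)\<close>,
    which is \<open>\<epsilon> * n\<close> for this value.\<close>
  define \<sigma> where "\<sigma> = \<epsilon> / 4"
  let ?R = "sqrt (real n * meas_complexity n \<nu> / \<epsilon>)"
  have "\<sigma> > 0" using \<epsilon> by (simp add: \<sigma>_def)
  from exists_good_tilt[OF this] obtain z :: "nat \<Rightarrow> real"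
    where z: "(\<Sum>i<n. \<bar>z i\<bar>) \<le> 2 * real n"
    and S: "\<sigma> * (\<Sum>i<n. pmf_cov (tilt (\<lambda>j. \<sigma> * z j)) (\<lambda>y. y i) (drift i)) \<le> 2 * meas_complexity n \<nu>"
    by blast
  define \<theta> where "\<theta> = (\<lambda>j. \<sigma> * z j)"
  have R0: "0 \<le> ?R" using meas_complexity_nonneg \<epsilon> by simp
  have "2 * (\<Sum>i<n. \<bar>\<theta> i\<bar>) = 2 * \<sigma> * (\<Sum>i<n. \<bar>z i\<bar>)"
    using \<open>\<sigma> > 0\<close> by (simp add: \<theta>_def abs_mult sum_distrib_left mult_ac)
  also have "\<dots> \<le> 2 * \<sigma> * (2 * real n)"
    using z \<open>\<sigma> > 0\<close> by (intro mult_left_mono) auto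
  finally have close: "2 * (\<Sum>i<n. \<bar>\<theta> i\<bar>) \<le> \<epsilon> * n" by (simp add: \<sigma>_def)
  have W: "W1 n (tilt \<theta>) \<xi> \<le> 2 * ?R"
    if "product_on_cube n \<xi>" and "\<forall>i<n. measure_pmf.expectation \<xi> (\<lambda>y. y i) =
      measure_pmf.expectation (tilt \<theta>) (\<lambda>y. y i)" for \<xi>
  proof -
    let ?S = "\<Sum>i<n. pmf_cov (tilt \<theta>) (\<lambda>y. y i) (drift i)"
    have "?S \<le> 8 * meas_complexity n \<nu> / \<epsilon>"
      using S \<epsilon> unfolding \<theta>_def \<sigma>_def by (simp add: field_simps)
    then have "n * ?S \<le> n * (8 * meas_complexity n \<nu> / \<epsilon>)"
      by (rule mult_left_mono) simp
    \<comment> \<open>The factor 8 is enlarged to a perfect square, so that half the root is exactly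
      \<open>2 * ?R\<close>.\<close>
    also have "\<dots> \<le> 16 * (n * meas_complexity n \<nu> / \<epsilon>)"
      using meas_complexity_nonneg \<epsilon> by (simp add: field_simps)
    finally have S16: "sqrt (n * ?S) \<le> sqrt (16 * (n * meas_complexity n \<nu> / \<epsilon>))"
      by (rule real_sqrt_le_mono)
    have "W1 n (tilt \<theta>) \<xi> \<le> sqrt (n * ?S) / 2"
      using W1_tilt_le that by blast
    also have "\<dots> \<le> sqrt (16 * (n * meas_complexity n \<nu> / \<epsilon>)) / 2"
      using S16 by simp
    also have "\<dots> = 2 * ?R"
      using real_sqrt_mult[of 16 "n * meas_complexity n \<nu> / \<epsilon>"] by simp
    finally show ?thesis .
  qed
  show "\<exists>\<nu>t. set_pmf \<nu>t \<subseteq> cube n \<and> (\<forall>y\<in>cube n. pmf \<nu>t y > 0) \<and>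
       (\<forall>y\<in>cube n. \<bar>log_density n \<nu> y - log_density n \<nu>t y\<bar> \<le> \<epsilon> * real n) \<and>
       (\<forall>\<xi>. product_on_cube n \<xi> \<and>
            (\<forall>i<n. measure_pmf.expectation \<xi> (\<lambda>y. y i) = measure_pmf.expectation \<nu>t (\<lambda>y. y i))
          \<longrightarrow> W1 n \<nu>t \<xi> \<le> 2^7 * ?R + 4 * real n * exp (- 1 / (64 * \<epsilon>^2))
            \<and> (\<exists>I. I \<subseteq> {..<n} \<and>
                 real (card I) \<ge> real n - 2 * real n * exp (- 1 / (32 * \<epsilon>^2)) \<and>
                 W1 n \<nu>t (glue I \<xi> ({..<n} - I) \<nu>t) \<le> 2^6 * ?R))"
  proof (rule exI[of _ "tilt \<theta>"], intro conjI ballI allI impI)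
    fix y assume "y \<in> cube n"
    then show "pmf (tilt \<theta>) y > 0"
      by (rule pmf_tilt_pos)
    show "\<bar>log_density n \<nu> y - log_density n (tilt \<theta>) y\<bar> \<le> \<epsilon> * real n"
      using log_density_tilt[OF \<open>y \<in> cube n\<close>, of \<theta>] close by linarith
  next
    fix \<xi>
    assume \<xi>: "product_on_cube n \<xi> \<and>
      (\<forall>i<n. measure_pmf.expectation \<xi> (\<lambda>y. y i) = measure_pmf.expectation (tilt \<theta>) (\<lambda>y. y i))"
    then have W\<xi>: "W1 n (tilt \<theta>) \<xi> \<le> 2 * ?R" using W by blast
    have R: "2 * ?R \<le> 2^7 * ?R" "2 * ?R \<le> 2^6 * ?R"
      using R0 by (intro mult_right_mono; simp)+
    have "0 \<le> 4 * real n * exp (- 1 / (64 * \<epsilon>^2))" by simp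
    then show "W1 n (tilt \<theta>) \<xi> \<le> 2^7 * ?R + 4 * real n * exp (- 1 / (64 * \<epsilon>^2))"
      using W\<xi> R(1) by linarith
    \<comment> \<open>With \<open>I\<close> the full index set the glued measure is
      \<open>\<xi>\<close> itself, so the same transport bound serves, and \<open>card I = n\<close>
      exceeds the required size.\<close>
    have "glue {..<n} \<xi> ({..<n} - {..<n}) (tilt \<theta>) = \<xi>"
      using \<xi> by (intro glue_full) (simp add: product_on_cube_def)
    then show "\<exists>I. I \<subseteq> {..<n} \<and> real (card I) \<ge> real n - 2 * real n * exp (- 1 / (32 * \<epsilon>^2)) \<and>
        W1 n (tilt \<theta>) (glue I \<xi> ({..<n} - I) (tilt \<theta>)) \<le> 2^6 * ?R"
      using order_trans[OF W\<xi> R(2)] by (intro exI[of _ "{..<n}"]) simp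
  qed (simp add: set_tilt)
qed

end
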